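(* Let $(\mathcal{L},\circ,[\cdot,\cdot])$ be a semisimple Lie--Jordan algebra, and let $\mathcal{L}_0$ denote its semisimple Lie part (as defined in the context: $\mathcal{L}_0=\mathcal{L}$ in the non-unital case, and $\mathcal{L}=\mathbb{R}\mathds{1}\oplus\mathcal{L}_0$ in the unital case). Then the Jordan algebra $(\mathcal{L},\circ)$ is generated by three elements, together with the identity $\mathds{1}$ in the unital case. More precisely, there exist two elements $a,b\in\mathcal{L}_0$ which generate the Lie algebra $(\mathcal{L}_0,[\cdot,\cdot])$, and for any such $a,b$, setting $c=[a,b]$, every element of $\mathcal{L}$ is a real linear combination of iterated Jordan products of $a,b,c$ (and, in the unital case, of $\mathds{1}$).
   Context: A Lie--Jordan algebra is a real vector space $\mathcal{L}$ with two bilinear operations, a symmetric one $\circ$ (the Jordan product) and an antisymmetric one $[\cdot,\cdot]$ (the Lie product), such that for all $a,b,c\in\mathcal{L}$: (Jacobi) $[[a,b],c]+[[c,a],b]+[[b,c],a]=0$; (Leibniz) $[a,b\circ c]=[a,b]\circ c+b\circ[a,c]$; (associator identity) $(a\circ b)\circ c-a\circ(b\circ c)=[b,[c,a]]$. The motivating example is the space of self-adjoint elements of an associative $*$-algebra with $a\circ b=\frac12(ab+ba)$ and $[a,b]=\frac{i}{2}(ab-ba)$; e.g. the Hermitian $N\times N$ matrices, identified with $\mathfrak{u}(N)$. A non-unital Lie--Jordan algebra $\mathcal{L}$ is called semisimple if the Lie algebra $(\mathcal{L},[\cdot,\cdot])$ is semisimple; in this case put $\mathcal{L}_0=\mathcal{L}$.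 Since the unit cannot be generated by Lie products, it is added by hand: a Lie--Jordan algebra $\mathcal{L}$ with unit $\mathds{1}$ (i.e. $\mathds{1}\circ a=a$ for all $a$) is called semisimple if $\mathcal{L}=\mathbb{R}\mathds{1}\oplus\mathcal{L}_0$ as vector spaces, where $\mathcal{L}_0$ is a Lie subalgebra of $(\mathcal{L},[\cdot,\cdot])$ which is semisimple. Semisimple Lie algebras are finite-dimensional. A set of elements $a_1,\dots,a_k$ generates an algebra (with respect to a given product) if every element of the algebra is a linear combination of iterated products of $a_1,\dots,a_k$ (a single $a_i$ counting as a product). It may be taken as known (Kuranishi) that every semisimple Lie algebra over $\mathbb{R}$ or $\mathbb{C}$ is generated as a Lie algebra by two elements. *)

theory Defs
  imports "HOL-Analysis.Analysis"
begin

locale real_lie_algebra =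
  fixes lie :: "'a::real_vector \<Rightarrow> 'a \<Rightarrow> 'a"
  assumes lie_bilinear: "bilinear lie"
    and lie_antisym: "lie a b = - lie b a"
    and lie_jacobi: "lie (lie a b) c + lie (lie c a) b + lie (lie b c) a = 0"

locale lie_jordan_algebra = real_lie_algebra lie
  for jordan :: "'a::real_vector \<Rightarrow> 'a \<Rightarrow> 'a"
    and lie :: "'a \<Rightarrow> 'a \<Rightarrow> 'a" +
  assumes jordan_bilinear: "bilinear jordan"
    and jordan_sym: "jordan a b = jordan b a"
    and leibniz: "lie a (jordan b c) = jordan (lie a b) c + jordan b (lie a c)"
    and associator: "jordan (jordan a b) c - jordan a (jordan b c) = lie b (lie c a)"

definition lie_subalgebra :: "('a::real_vector \<Rightarrow> 'a \<Rightarrow> 'a) \<Rightarrow> 'a set \<Rightarrow> bool" where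
  "lie_subalgebra lie S \<longleftrightarrow> subspace S \<and> (\<forall>x\<in>S. \<forall>y\<in>S. lie x y \<in> S)"

definition lie_ideal :: "('a::real_vector \<Rightarrow> 'a \<Rightarrow> 'a) \<Rightarrow> 'a set \<Rightarrow> 'a set \<Rightarrow> bool" where
  "lie_ideal lie S I \<longleftrightarrow> subspace I \<and> I \<subseteq> S \<and> (\<forall>x\<in>S. \<forall>y\<in>I. lie x y \<in> I)"

definition lie_derived :: "('a::real_vector \<Rightarrow> 'a \<Rightarrow> 'a) \<Rightarrow> 'a set \<Rightarrow> 'a set" where
  "lie_derived lie S = span {lie x y | x y. x \<in> S \<and> y \<in> S}"

definition lie_solvable :: "('a::real_vector \<Rightarrow> 'a \<Rightarrow> 'a) \<Rightarrow> 'a set \<Rightarrow> bool" where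
  "lie_solvable lie S \<longleftrightarrow> (\<exists>n. (lie_derived lie ^^ n) S = {0})"

text \<open>
  Semisimplicity means finite dimension and vanishing radical. The zero algebra counts as
  semisimple, so that the one-dimensional unital algebra is covered.
\<close>

definition semisimple_lie :: "('a::real_vector \<Rightarrow> 'a \<Rightarrow> 'a) \<Rightarrow> 'a set \<Rightarrow> bool" where
  "semisimple_lie lie S \<longleftrightarrow>
     lie_subalgebra lie S \<and>
     (\<exists>B. finite B \<and> S = span B) \<and>
     (\<forall>I. lie_ideal lie S I \<and> lie_solvable lie I \<longrightarrow> I = {0})"

definition jordan_unit :: "('a \<Rightarrow> 'a \<Rightarrow> 'a) \<Rightarrow> 'a \<Rightarrow> bool" where
  "jordan_unit jordan u \<longleftrightarrow> (\<forall>a. jordan u a = a)"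

definition unital_semisimple ::
    "('a::real_vector \<Rightarrow> 'a \<Rightarrow> 'a) \<Rightarrow> ('a \<Rightarrow> 'a \<Rightarrow> 'a) \<Rightarrow> 'a \<Rightarrow> 'a set \<Rightarrow> bool" where
  "unital_semisimple jordan lie u L0 \<longleftrightarrow>
     jordan_unit jordan u \<and>
     semisimple_lie lie L0 \<and>
     span {u} \<inter> L0 = {0} \<and>
     (\<forall>x. \<exists>r. \<exists>y\<in>L0. x = r *\<^sub>R u + y)"

inductive_set iterated_products :: "('a \<Rightarrow> 'a \<Rightarrow> 'a) \<Rightarrow> 'a set \<Rightarrow> 'a set"
  for prd :: "'a \<Rightarrow> 'a \<Rightarrow> 'a" and G :: "'a set" where
  generator: "x \<in> G \<Longrightarrow> x \<in> iterated_products prd G"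
| product: "x \<in> iterated_products prd G \<Longrightarrow> y \<in> iterated_products prd G \<Longrightarrow>
    prd x y \<in> iterated_products prd G"

definition generates :: "('a::real_vector \<Rightarrow> 'a \<Rightarrow> 'a) \<Rightarrow> 'a set \<Rightarrow> 'a set \<Rightarrow> bool" where
  "generates prd G S \<longleftrightarrow> G \<subseteq> S \<and> S \<subseteq> span (iterated_products prd G)"

end

theory Submission
  imports Defs "HOL-Computational_Algebra.Fundamental_Theorem_Algebra"
begin

text \<open>
  The associator identity makes every Jordan-closed subspace closed under \<open>[x, [y, z]]\<close>, so the
  Jordan algebra generated by \<open>a\<close>, \<open>b\<close> and \<open>[a, b]\<close> contains all right-normed Lie words in \<open>a\<close>
  and \<open>b\<close>, and these span the Lie algebra generated by \<open>a\<close> and \<open>b\<close>.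

  The existence of two Lie generators is not drawn from Kuranishi's theorem. The complexification
  of a Lie-Jordan algebra is an associative algebra with involution, whose self-adjoint part is the
  given algebra. A square-zero ideal would yield an abelian Lie ideal, so by semisimplicity this
  algebra is semiprime and hence has an identity element. In the non-unital case the identity
  spans an abelian ideal, so the algebra is zero. In the unital case the centre is one-dimensional
  and the algebra is prime, and the identity is a sum of orthogonal self-adjoint minimal idempotents
  \<open>e\<^sub>i\<close> (the algebra is a full matrix algebra). Choose \<open>x\<^sub>i\<^sub>j \<noteq> 0\<close> in \<open>e\<^sub>i A e\<^sub>j\<close> and put
  \<open>a = \<Sum> 2\<^sup>i e\<^sub>i\<close>, \<open>b = \<Sum> x\<^sub>i\<^sub>j + x\<^sub>i\<^sub>j\<^sup>*\<close> over \<open>i < j\<close>. The square of \<open>ad a\<close> separates the summands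
  of \<open>b\<close>, and brackets of these summands and their images under \<open>ad a\<close> give the diagonal
  differences \<open>e\<^sub>i - e\<^sub>j\<close>.
\<close>

subsection \<open>Finite-dimensional complex algebras with involution\<close>

text \<open>The carrier is a real vector space on which \<open>J\<close> is multiplication by the
  imaginary unit, so \<open>star\<close> is conjugate-linear; dimension arguments stay over the
  reals.\<close>

locale involutive_algebra =
  fixes mul :: "'c::real_vector \<Rightarrow> 'c \<Rightarrow> 'c" (infixl "\<cdot>" 70)
    and J star :: "'c \<Rightarrow> 'c"
  assumes mul_bilinear: "bilinear mul"
    and mul_assoc: "x \<cdot> y \<cdot> z = x \<cdot> (y \<cdot> z)"
    and J_linear: "linear J"
    and J_J [simp]: "J (J x) = - x"
    and J_mul_left [simp]: "J x \<cdot> y = J (x \<cdot> y)"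
    and J_mul_right [simp]: "x \<cdot> J y = J (x \<cdot> y)"
    and star_linear: "linear star"
    and star_star [simp]: "star (star x) = x"
    and star_mul [simp]: "star (x \<cdot> y) = star y \<cdot> star x"
    and star_J [simp]: "star (J x) = - J (star x)"
    and finite_dim: "\<exists>B::'c set. finite B \<and> span B = UNIV"
begin

lemmas mul_simps [simp] =
  bilinear_ladd[OF mul_bilinear] bilinear_radd[OF mul_bilinear]
  bilinear_lmul[OF mul_bilinear] bilinear_rmul[OF mul_bilinear]
  bilinear_lneg[OF mul_bilinear] bilinear_rneg[OF mul_bilinear]
  bilinear_lsub[OF mul_bilinear] bilinear_rsub[OF mul_bilinear]
  bilinear_lzero[OF mul_bilinear] bilinear_rzero[OF mul_bilinear]

lemmas J_simps [simp] =
  linear_add[OF J_linear] linear_diff[OF J_linear] linear_neg[OF J_linear]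
  linear_cmul[OF J_linear] linear_0[OF J_linear]

lemmas star_simps [simp] =
  linear_add[OF star_linear] linear_diff[OF star_linear] linear_neg[OF star_linear]
  linear_cmul[OF star_linear] linear_0[OF star_linear]

lemma mul_sum_left: "(\<Sum>k\<in>K. f k) \<cdot> y = (\<Sum>k\<in>K. f k \<cdot> y)"
  by (induction K rule: infinite_finite_induct) auto

lemma mul_sum_right: "y \<cdot> (\<Sum>k\<in>K. f k) = (\<Sum>k\<in>K. y \<cdot> f k)"
  by (induction K rule: infinite_finite_induct) auto

lemma star_sum: "star (\<Sum>k\<in>K. f k) = (\<Sum>k\<in>K. star (f k))"
  by (rule linear_sum[OF star_linear])

lemma J_eq_0_iff [simp]: "J x = 0 \<longleftrightarrow> x = 0"
  by (metis J_J J_simps(5) neg_equal_0_iff_equal)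

lemma star_eq_0_iff [simp]: "star x = 0 \<longleftrightarrow> x = 0"
  by (metis star_star star_simps(5))

definition scaleC :: "complex \<Rightarrow> 'c \<Rightarrow> 'c" where
  "scaleC z x = Re z *\<^sub>R x + Im z *\<^sub>R J x"

lemma scaleC_mul_left [simp]: "scaleC z x \<cdot> y = scaleC z (x \<cdot> y)"
  and scaleC_mul_right [simp]: "x \<cdot> scaleC z y = scaleC z (x \<cdot> y)"
  and scaleC_scaleC [simp]: "scaleC z (scaleC w x) = scaleC (z * w) x"
  and scaleC_one [simp]: "scaleC 1 x = x"
  and scaleC_zero_left [simp]: "scaleC 0 x = 0"
  and scaleC_zero_right [simp]: "scaleC z 0 = 0"
  and scaleC_of_real [simp]: "scaleC (of_real r) x = r *\<^sub>R x"
  and scaleC_add: "scaleC z (x + y) = scaleC z x + scaleC z y"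
  and scaleC_add_left: "scaleC (z + w) x = scaleC z x + scaleC w x"
  and star_scaleC [simp]: "star (scaleC z x) = scaleC (cnj z) (star x)"
  by (simp_all add: scaleC_def algebra_simps)

lemma scaleC_eq_0_iff [simp]: "scaleC z x = 0 \<longleftrightarrow> z = 0 \<or> x = 0"
proof
  assume z: "scaleC z x = 0"
  show "z = 0 \<or> x = 0"
  proof (cases "z = 0")
    case False
    then have "x = scaleC (inverse z) (scaleC z x)" by simp
    with z show ?thesis by simp
  qed simp
qed auto

lemma scaleC_right_cancel: "x \<noteq> 0 \<Longrightarrow> scaleC z x = scaleC w x \<longleftrightarrow> z = w"
proof -
  assume "x \<noteq> 0"
  have "scaleC z x = scaleC w x \<longleftrightarrow> scaleC (z - w) x = 0"
    by (simp add: scaleC_def algebra_simps)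
  with \<open>x \<noteq> 0\<close> show ?thesis by simp
qed

text \<open>A member of least dimension is minimal under inclusion. This supplies minimal right
  ideals and, by way of annihilators, maximal idempotents and maximal orthogonal families.\<close>

lemma minimal_subspace:
  assumes "P S" and sub: "\<And>S. P S \<Longrightarrow> subspace S"
  obtains R where "P R" "\<And>S. P S \<Longrightarrow> S \<subseteq> R \<Longrightarrow> S = (R :: 'c set)"
proof -
  obtain B0 :: "'c set" where B0: "finite B0" "span B0 = UNIV"
    using finite_dim by auto
  obtain B where B: "B \<subseteq> B0" "independent B" "span B = UNIV"
    by (metis B0(2) maximal_independent_subset span_mono span_span top.extremum_uniqueI)
  interpret V: finite_dimensional_vector_space "scaleR :: real \<Rightarrow> 'c \<Rightarrow> 'c" B
    using B B0 finite_subset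
    by unfold_locales (auto simp: dependent_raw_def span_raw_def)
  obtain R where R: "P R" "\<And>S. P S \<Longrightarrow> dim R \<le> dim S"
    using arg_min_natI[of P S dim] arg_min_nat_le[of P _ dim] assms(1) by metis
  show ?thesis
  proof (rule that[OF R(1)])
    fix S assume S: "P S" "S \<subseteq> R"
    then show "S = R"
      using V.subspace_dim_equal[folded subspace_raw_def dim_raw_def, of S R] sub R by auto
  qed
qed

section \<open>Idempotents and identity elements of semiprime algebras\<close>

definition right_ideal_of :: "'c set \<Rightarrow> 'c set \<Rightarrow> bool" where
  "right_ideal_of B R \<longleftrightarrow> subspace R \<and> R \<subseteq> B \<and> (\<forall>r\<in>R. \<forall>b\<in>B. r \<cdot> b \<in> R)"

text \<open>Relative to a subset \<open>B\<close>, because it is applied to the whole algebra and,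
  in \<open>prime_algebraI\<close>, to an ideal.\<close>

definition semiprime_on :: "'c set \<Rightarrow> bool" where
  "semiprime_on B \<longleftrightarrow> subspace B \<and> (\<forall>x\<in>B. \<forall>y\<in>B. x \<cdot> y \<in> B) \<and>
     (\<forall>x\<in>B. x \<noteq> 0 \<longrightarrow> (\<exists>y\<in>B. x \<cdot> y \<cdot> x \<noteq> 0))"

lemma right_ideal_of_mul_image:
  assumes R: "right_ideal_of B R" and c: "c \<in> R"
  shows "right_ideal_of B ((\<cdot>) c ` R)"
proof -
  have "linear ((\<cdot>) c)" using mul_bilinear by (simp add: bilinear_def)
  then have "subspace ((\<cdot>) c ` R)"
    using R by (auto simp: right_ideal_of_def intro: linear_subspace_image)
  moreover have "c \<cdot> r \<in> B" if "r \<in> R" for r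
    using R c that unfolding right_ideal_of_def by blast
  moreover have "c \<cdot> r \<cdot> b \<in> (\<cdot>) c ` R" if "r \<in> R" "b \<in> B" for r b
    using R that unfolding right_ideal_of_def by (simp add: mul_assoc)
  ultimately show ?thesis by (auto simp: right_ideal_of_def)
qed

text \<open>Brauer's lemma. Left multiplication by an element of a minimal right ideal
  \<open>R\<close> inside \<open>K\<close> either kills \<open>R\<close> or maps it onto
  \<open>R\<close>; surjectivity yields the idempotent and the right inverses in its corner.\<close>

lemma division_idempotent:
  assumes B: "semiprime_on B" and K: "right_ideal_of B K" "K \<noteq> {0}"
  obtains e where "e \<in> K" "e \<noteq> 0" "e \<cdot> e = e"
    "\<And>x. x \<in> B \<Longrightarrow> e \<cdot> x \<cdot> e \<noteq> 0 \<Longrightarrow> \<exists>v\<in>B. e \<cdot> x \<cdot> e \<cdot> v = e"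
proof -
  define P where "P R \<longleftrightarrow> right_ideal_of B R \<and> R \<subseteq> K \<and> R \<noteq> {0}" for R
  have "P K" using K by (simp add: P_def)
  moreover have "subspace S" if "P S" for S
    using that by (simp add: P_def right_ideal_of_def)
  ultimately obtain R where R: "P R" "\<And>S. P S \<Longrightarrow> S \<subseteq> R \<Longrightarrow> S = R"
    using minimal_subspace[of P K] by blast
  have rR: "right_ideal_of B R" and RK: "R \<subseteq> K" and "R \<noteq> {0}"
    using R by (auto simp: P_def)
  have sR: "subspace R" and RB: "R \<subseteq> B" and Rm: "\<And>r b. r \<in> R \<Longrightarrow> b \<in> B \<Longrightarrow> r \<cdot> b \<in> R"
    using rR by (auto simp: right_ideal_of_def)
  have minR: "S = R" if "right_ideal_of B S" "S \<subseteq> R" "s \<in> S" "s \<noteq> 0" for S s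
    using R(2)[of S] that RK by (auto simp: P_def)
  have image: "(\<cdot>) c ` R = R" if "c \<in> R" "r \<in> R" "c \<cdot> r \<noteq> 0" for c r
    by (rule minR[OF right_ideal_of_mul_image[OF rR that(1)] _ _ that(3)])
      (use that RB Rm in auto)
  obtain r0 where r0: "r0 \<in> R" "r0 \<noteq> 0"
    using \<open>R \<noteq> {0}\<close> sR subspace_0 by blast
  then obtain y where y: "y \<in> B" "r0 \<cdot> y \<cdot> r0 \<noteq> 0"
    using B RB by (auto simp: semiprime_on_def)
  \<comment> \<open>Semiprimeness gives an element \<open>c\<close> of \<open>R\<close> that does
    not annihilate \<open>R\<close>, so \<open>c R = R\<close> and \<open>c = c e\<close> for some
    \<open>e\<close> in \<open>R\<close>.\<close>
  define c where "c = r0 \<cdot> y"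
  have c: "c \<in> R" "c \<cdot> r0 \<noteq> 0" using r0 y Rm by (auto simp: c_def)
  obtain e where e: "e \<in> R" "c \<cdot> e = c"
    using image[OF c(1) r0(1) c(2)] c(1) by (metis imageE)
  \<comment> \<open>The right annihilator of \<open>c\<close> in \<open>R\<close> is a right ideal
    that misses \<open>r0\<close>, hence zero; it contains \<open>e e - e\<close>.\<close>
  have ann: "r = 0" if "r \<in> R" "c \<cdot> r = 0" for r
  proof (rule ccontr)
    assume "r \<noteq> 0"
    have "right_ideal_of B {r \<in> R. c \<cdot> r = 0}"
      using sR RB Rm by (auto simp: right_ideal_of_def subspace_def simp flip: mul_assoc)
    then have "{r \<in> R. c \<cdot> r = 0} = R"
      by (rule minR[where s = r]) (use that \<open>r \<noteq> 0\<close> in auto)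
    then show False using r0 c by auto
  qed
  have "e \<cdot> e - e = 0"
    by (rule ann) (use e RB Rm sR in \<open>auto simp: subspace_diff simp flip: mul_assoc\<close>)
  then have ee: "e \<cdot> e = e" by simp
  show ?thesis
  proof (rule that[of e])
    show "e \<in> K" "e \<noteq> 0" "e \<cdot> e = e" using e RK ee c by auto
    fix x assume x: "x \<in> B" "e \<cdot> x \<cdot> e \<noteq> 0"
    have "e \<cdot> x \<cdot> e \<in> R" using x e RB Rm by blast
    moreover have "e \<cdot> x \<cdot> e \<cdot> e \<noteq> 0" using x ee by (simp add: mul_assoc)
    ultimately have "(\<cdot>) (e \<cdot> x \<cdot> e) ` R = R" using image e(1) by blast
    then show "\<exists>v\<in>B. e \<cdot> x \<cdot> e \<cdot> v = e" using e(1) RB by (metis imageE subsetD)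
  qed
qed

text \<open>Among the idempotents, \<open>f\<close> is chosen with minimal right annihilator. A
  nonzero annihilator would contain an idempotent that enlarges \<open>f\<close>, so it is zero, and
  \<open>f (x - f x) = 0\<close> makes \<open>f\<close> a left identity.\<close>

lemma semiprime_on_identity:
  assumes B: "semiprime_on B"
  obtains f where "f \<in> B" "\<And>x. x \<in> B \<Longrightarrow> f \<cdot> x = x" "\<And>x. x \<in> B \<Longrightarrow> x \<cdot> f = x"
proof -
  have sB: "subspace B" and Bm: "\<And>x y. x \<in> B \<Longrightarrow> y \<in> B \<Longrightarrow> x \<cdot> y \<in> B"
    and sp: "\<And>x. x \<in> B \<Longrightarrow> x \<noteq> 0 \<Longrightarrow> \<exists>y\<in>B. x \<cdot> y \<cdot> x \<noteq> 0"
    using B by (auto simp: semiprime_on_def)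
  define P where "P S \<longleftrightarrow> (\<exists>f\<in>B. f \<cdot> f = f \<and> S = {x \<in> B. f \<cdot> x = 0})" for S
  have ri: "right_ideal_of B {x \<in> B. f \<cdot> x = 0}" for f
    using sB Bm by (auto simp: right_ideal_of_def subspace_def simp flip: mul_assoc)
  have "P B" unfolding P_def by (rule bexI[of _ 0]) (use sB subspace_0 in auto)
  moreover have "subspace S" if "P S" for S
    using that ri by (auto simp: P_def right_ideal_of_def)
  ultimately obtain R where R: "P R" "\<And>S. P S \<Longrightarrow> S \<subseteq> R \<Longrightarrow> S = R"
    using minimal_subspace[of P] by blast
  then obtain f where f: "f \<in> B" "f \<cdot> f = f" "R = {x \<in> B. f \<cdot> x = 0}"
    by (auto simp: P_def)
  have "R = {0}"
  proof (rule ccontr)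
    assume "R \<noteq> {0}"
    then obtain e where e: "e \<in> R" "e \<noteq> 0" "e \<cdot> e = e"
      using division_idempotent[OF B ri[of f]] f(3) by metis
    \<comment> \<open>This is \<open>1 - (1 - e) (1 - f)\<close> written without an identity. From
      \<open>f f' = f\<close> its annihilator is no larger than that of \<open>f\<close>, and
      \<open>f' e = e\<close> excludes \<open>e\<close>.\<close>
    define f' where "f' = f + (e - e \<cdot> f)"
    have fe: "f \<cdot> e = 0" "e \<in> B" using e f by auto
    have fe': "f \<cdot> (e \<cdot> x) = 0" for x using fe by (simp flip: mul_assoc)
    have ee': "e \<cdot> (e \<cdot> x) = e \<cdot> x" for x using e by (simp flip: mul_assoc)
    have ff': "f \<cdot> f' = f" "f' \<cdot> e = e" "f' \<cdot> f' = f'"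
      using fe f(2) e by (simp_all add: f'_def mul_assoc fe' ee')
    have "f' \<in> B" using fe f(1) sB Bm by (auto simp: f'_def intro!: subspace_add subspace_diff)
    then have "P {x \<in> B. f' \<cdot> x = 0}" using ff' by (auto simp: P_def)
    moreover have "{x \<in> B. f' \<cdot> x = 0} \<subseteq> R"
    proof safe
      fix x assume x: "x \<in> B" "f' \<cdot> x = 0"
      have "f \<cdot> x = f \<cdot> (f' \<cdot> x)" using ff' by (simp flip: mul_assoc)
      then show "x \<in> R" using x f by simp
    qed
    ultimately have "{x \<in> B. f' \<cdot> x = 0} = R" by (rule R(2))
    then show False using e ff' by auto
  qed
  have left: "f \<cdot> x = x" if "x \<in> B" for x
  proof -
    have "x - f \<cdot> x \<in> R"
      using f that sB Bm by (auto intro!: subspace_diff simp flip: mul_assoc)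
    then show ?thesis using \<open>R = {0}\<close> by auto
  qed
  have right: "x \<cdot> f = x" if "x \<in> B" for x
  proof (rule ccontr)
    assume "x \<cdot> f \<noteq> x"
    \<comment> \<open>Since \<open>w f = 0\<close> and \<open>f\<close> is a left identity,
      \<open>w y = w f y = 0\<close> on \<open>B\<close>, against semiprimeness.\<close>
    define w where "w = x - x \<cdot> f"
    have "w \<in> B" "w \<noteq> 0"
      using that f sB Bm \<open>x \<cdot> f \<noteq> x\<close> by (auto simp: w_def intro!: subspace_diff)
    then obtain y where y: "y \<in> B" "w \<cdot> y \<cdot> w \<noteq> 0" using sp by blast
    have "w \<cdot> y = w \<cdot> (f \<cdot> y)" using left y by simp
    also have "\<dots> = 0" using f left[OF y(1)] by (simp add: w_def mul_assoc)
    finally show False using y by simp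
  qed
  show ?thesis using that f(1) left right by blast
qed

section \<open>Division corners are scalar\<close>

text \<open>Horner evaluation at \<open>s\<close> with \<open>e\<close> in the role of 1: polynomial
  evaluation in the corner \<open>e A e\<close>, whose identity is \<open>e\<close>.\<close>

definition poly_eval :: "'c \<Rightarrow> 'c \<Rightarrow> complex poly \<Rightarrow> 'c" where
  "poly_eval e s p = fold_coeffs (\<lambda>a v. scaleC a e + s \<cdot> v) p 0"

lemma poly_eval_0 [simp]: "poly_eval e s 0 = 0"
  by (simp add: poly_eval_def)

lemma poly_eval_pCons [simp]: "poly_eval e s (pCons a p) = scaleC a e + s \<cdot> poly_eval e s p"
  by (cases "p = 0"; cases "a = 0") (simp_all add: poly_eval_def fold_coeffs_pCons_not_0_0_eq)

lemma poly_eval_add: "poly_eval e s (p + q) = poly_eval e s p + poly_eval e s q"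
proof (induction p arbitrary: q)
  case (pCons a p)
  then show ?case by (cases q) (simp add: scaleC_add_left algebra_simps)
qed simp

lemma poly_eval_smult: "poly_eval e s (smult c p) = scaleC c (poly_eval e s p)"
  by (induction p) (simp_all add: scaleC_add)

lemma poly_eval_sum: "poly_eval e s (\<Sum>k\<in>K. f k) = (\<Sum>k\<in>K. poly_eval e s (f k))"
  by (induction K rule: infinite_finite_induct) (simp_all add: poly_eval_add)

text \<open>Otherwise the powers of \<open>s\<close> applied to \<open>e\<close> would form an
  infinite independent set, against finite dimension.\<close>

lemma poly_eval_annihilated: "\<exists>p. p \<noteq> 0 \<and> poly_eval e s p = 0"
proof (rule ccontr)
  assume none: "\<nexists>p. p \<noteq> 0 \<and> poly_eval e s p = 0"
  define pw where "pw n = poly_eval e s (monom 1 n)" for n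
  have comb: "(\<Sum>k\<in>K. r k *\<^sub>R pw k) = poly_eval e s (\<Sum>k\<in>K. monom (of_real (r k)) k)" for K r
    unfolding poly_eval_sum pw_def
    by (simp add: smult_monom flip: scaleC_of_real poly_eval_smult)
  have coeffs: "r k = 0" if "finite K" "(\<Sum>k\<in>K. r k *\<^sub>R pw k) = 0" "k \<in> K" for K r k
  proof -
    have "(\<Sum>k\<in>K. monom (of_real (r k) :: complex) k) = 0" using none that comb by auto
    then have "coeff (\<Sum>k\<in>K. monom (of_real (r k) :: complex) k) k = 0" by simp
    then show ?thesis using that by (simp add: coeff_sum)
  qed
  \<comment> \<open>Independence concerns the set \<open>range pw\<close>; injectivity turns a
    relation among its vectors into one among exponents.\<close>
  have "inj pw"
  proof (rule injI, rule ccontr)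
    fix m n assume mn: "pw m = pw n" "m \<noteq> n"
    then have "(\<Sum>k\<in>{m, n}. (if k = m then 1 else - 1) *\<^sub>R pw k) = 0" by simp
    then show False using coeffs[of "{m, n}" "\<lambda>k. if k = m then 1 else - 1" m] by simp
  qed
  have "independent (range pw)"
    unfolding independent_explicit_module
  proof (intro allI impI)
    fix t and u :: "'c \<Rightarrow> real" and v
    assume t: "finite t" "t \<subseteq> range pw" "(\<Sum>v\<in>t. u v *\<^sub>R v) = 0" "v \<in> t"
    then obtain k where k: "v = pw k" by blast
    have t_eq: "t = pw ` (pw -` t)" using t by auto
    have fin: "finite (pw -` t)" using t \<open>inj pw\<close> by (simp add: finite_vimageI)
    have "(\<Sum>k\<in>pw -` t. u (pw k) *\<^sub>R pw k) = 0"
      using t \<open>inj pw\<close> by (subst (asm) t_eq, subst (asm) sum.reindex)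
        (auto intro: inj_on_subset)
    then show "u v = 0" using coeffs[OF fin, of "\<lambda>k. u (pw k)" k] t k by simp
  qed
  moreover obtain B0 :: "'c set" where "finite B0" "span B0 = UNIV"
    using finite_dim by auto
  ultimately have "finite (range pw)"
    using independent_span_bound[of B0 "range pw"] by auto
  then show False using \<open>inj pw\<close> finite_imageD by blast
qed

text \<open>The minimal polynomial of \<open>s = e x e\<close> has a root \<open>l\<close>. The
  cofactor of \<open>X - l\<close> takes a nonzero, hence invertible, value at \<open>s\<close>, and
  cancelling it leaves \<open>s = l e\<close>.\<close>

lemma division_corner_scalar:
  assumes e: "e \<noteq> 0" "e \<cdot> e = e"
    and inv: "\<And>x. e \<cdot> x \<cdot> e \<noteq> 0 \<Longrightarrow> \<exists>v. e \<cdot> x \<cdot> e \<cdot> v = e"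
  shows "\<exists>z. e \<cdot> x \<cdot> e = scaleC z e"
proof -
  define s where "s = e \<cdot> x \<cdot> e"
  have ee: "e \<cdot> (e \<cdot> y) = e \<cdot> y" for y using e by (simp flip: mul_assoc)
  have s: "e \<cdot> s = s" "s \<cdot> e = s" "s \<cdot> (e \<cdot> y) = s \<cdot> y" for y
    using e by (simp_all add: s_def ee mul_assoc)
  have es: "e \<cdot> (s \<cdot> y) = s \<cdot> y" for y using s by (simp flip: mul_assoc)
  have ev_e: "e \<cdot> poly_eval e s p = poly_eval e s p" "poly_eval e s p \<cdot> e = poly_eval e s p" for p
    by (induction p) (auto simp: e es mul_assoc)
  obtain p where p: "p \<noteq> 0" "poly_eval e s p = 0"
    and min: "\<And>q. q \<noteq> 0 \<Longrightarrow> poly_eval e s q = 0 \<Longrightarrow> degree p \<le> degree q"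
    using poly_eval_annihilated[of e s]
      ex_has_least_nat[of "\<lambda>p. p \<noteq> 0 \<and> poly_eval e s p = 0" _ degree]
    by blast
  have "degree p \<noteq> 0"
  proof
    assume "degree p = 0"
    then obtain c where "p = [:c:]" using degree_eq_zeroE by blast
    with p e show False by auto
  qed
  then obtain l where "poly p l = 0"
    using fundamental_theorem_of_algebra[of p] by (auto simp: constant_degree)
  then obtain q where q: "p = [:- l, 1:] * q" using poly_eq_0_iff_dvd by (metis dvdE)
  then have "q \<noteq> 0" using p by auto
  then have "degree q < degree p" using q degree_mult_eq[of "[:- l, 1:]" q] by simp
  define t where "t = poly_eval e s q"
  have t: "t \<noteq> 0" "e \<cdot> t = t" "t \<cdot> e = t"
    using min[OF \<open>q \<noteq> 0\<close>] \<open>degree q < degree p\<close> ev_e by (auto simp: t_def)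
  obtain v where v: "t \<cdot> v = e" using inv[of t] t by auto
  have "0 = scaleC (- l) t + s \<cdot> t"
  proof -
    have "poly_eval e s (smult (- l) q + pCons 0 q) = 0" using p(2) by (simp add: q)
    then show ?thesis by (simp only: poly_eval_add poly_eval_smult t_def) simp
  qed
  then have "scaleC (- l) e \<cdot> (t \<cdot> v) + s \<cdot> (t \<cdot> v) = 0"
    using t by (metis mul_assoc mul_simps(1,9) scaleC_mul_left)
  then have "s = scaleC l e"
    using v s e by (simp add: scaleC_def algebra_simps)
  then show ?thesis unfolding s_def by blast
qed

section \<open>Prime algebras and minimal projections\<close>

definition prime_algebra :: bool where
  "prime_algebra \<longleftrightarrow> (\<forall>x y. (\<forall>b. x \<cdot> b \<cdot> y = 0) \<longrightarrow> x = 0 \<or> y = 0)"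

lemma prime_algebraD: "prime_algebra \<Longrightarrow> x \<noteq> 0 \<Longrightarrow> y \<noteq> 0 \<Longrightarrow> \<exists>b. x \<cdot> b \<cdot> y \<noteq> 0"
  unfolding prime_algebra_def by blast

text \<open>The annihilator of \<open>y\<close> is an ideal whose identity element is central in the whole algebra.\<close>

lemma prime_algebraI:
  assumes sp: "semiprime_on UNIV"
    and u: "\<And>x. u \<cdot> x = x" "\<And>x. x \<cdot> u = x"
    and center: "\<And>h. star h = h \<Longrightarrow> (\<And>x. h \<cdot> x = x \<cdot> h) \<Longrightarrow> \<exists>r. h = r *\<^sub>R u"
  shows prime_algebra
  unfolding prime_algebra_def
proof (intro allI impI)
  fix x y assume xy: "\<forall>b. x \<cdot> b \<cdot> y = 0"
  define B where "B = {b. \<forall>a. b \<cdot> a \<cdot> y = 0}"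
  have sB: "subspace B" by (auto simp: B_def subspace_def)
  have ideal: "c \<cdot> b \<in> B" "b \<cdot> c \<in> B" if "b \<in> B" for b c
  proof -
    have "b \<cdot> a \<cdot> y = 0" "b \<cdot> (c \<cdot> a) \<cdot> y = 0" for a
      using that by (auto simp: B_def)
    then show "c \<cdot> b \<in> B" "b \<cdot> c \<in> B" by (simp_all add: B_def mul_assoc)
  qed
  have "semiprime_on B"
    unfolding semiprime_on_def
  proof (intro conjI ballI impI sB)
    fix b assume b: "b \<in> B" "b \<noteq> 0"
    then obtain c where c: "b \<cdot> c \<cdot> b \<noteq> 0" using sp by (auto simp: semiprime_on_def)
    \<comment> \<open>Semiprimeness used twice puts further factors \<open>b\<close> between the
      outer ones, so the middle element lies in the ideal \<open>B\<close>.\<close>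
    then obtain d where "b \<cdot> c \<cdot> b \<cdot> d \<cdot> (b \<cdot> c \<cdot> b) \<noteq> 0"
      using sp by (auto simp: semiprime_on_def)
    then have "b \<cdot> (c \<cdot> b \<cdot> d \<cdot> b \<cdot> c) \<cdot> b \<noteq> 0" by (simp add: mul_assoc)
    then show "\<exists>y\<in>B. b \<cdot> y \<cdot> b \<noteq> 0" using ideal b by blast
  qed (use ideal in auto)
  then obtain f where f: "f \<in> B" "\<And>x. x \<in> B \<Longrightarrow> f \<cdot> x = x" "\<And>x. x \<in> B \<Longrightarrow> x \<cdot> f = x"
    using semiprime_on_identity by metis
  \<comment> \<open>Both \<open>f a\<close> and \<open>a f\<close> lie in \<open>B\<close>, so each
    equals \<open>f a f\<close>.\<close>
  have central: "f \<cdot> a = a \<cdot> f" for a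
    using f(2)[OF ideal(1)[OF f(1)], of a] f(3)[OF ideal(2)[OF f(1)], of a]
    by (simp add: mul_assoc)
  have central': "star f \<cdot> a = a \<cdot> star f" for a
    using central[of "star a"] by (metis star_mul star_star)
  \<comment> \<open>\<open>center\<close> concerns self-adjoint elements only; applied to the two
    self-adjoint parts of \<open>f\<close> it makes \<open>f\<close> a complex multiple of
    \<open>u\<close>. As \<open>f\<close> annihilates \<open>y\<close>, either \<open>y = 0\<close>
    or \<open>f = 0\<close>, and then \<open>B\<close> is zero.\<close>
  obtain r where r: "f + star f = r *\<^sub>R u"
    using center[of "f + star f"] central central' by (auto simp: add.commute)
  obtain t where t: "J (f - star f) = t *\<^sub>R u"
    using center[of "J (f - star f)"] central central' by auto
  have "2 *\<^sub>R f = (f + star f) - J (J (f - star f))" by (simp add: scaleR_2)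
  also have "\<dots> = scaleC (Complex r (- t)) u" unfolding t by (simp add: r scaleC_def)
  finally have ff: "2 *\<^sub>R f = scaleC (Complex r (- t)) u" .
  have "2 *\<^sub>R (f \<cdot> u \<cdot> y) = 0" using f(1) by (simp add: B_def)
  then have "scaleC (Complex r (- t)) y = 0"
    using ff u by (metis mul_simps(3) scaleC_mul_left)
  then consider "y = 0" | "f = 0" using ff by fastforce
  then show "x = 0 \<or> y = 0"
  proof cases
    case 2
    have "x \<in> B" using xy by (simp add: B_def)
    then show ?thesis using f(2) 2 by force
  qed simp
qed

lemma prime_semiprime: "prime_algebra \<Longrightarrow> semiprime_on UNIV"
  using prime_algebraD by (auto simp: semiprime_on_def)

definition minimal_projection :: "'c \<Rightarrow> bool" where
  "minimal_projection p \<longleftrightarrow> p \<noteq> 0 \<and> star p = p \<and> p \<cdot> p = p \<and> (\<forall>x. \<exists>z. p \<cdot> x \<cdot> p = scaleC z p)"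

text \<open>Primeness gives \<open>x y x \<noteq> 0\<close>, the corner at \<open>e\<close> makes
  \<open>x y e\<close> a nonzero multiple of \<open>e\<close>, and rescaling \<open>g y e\<close>
  produces \<open>v\<close>; then \<open>x v x = x\<close> forces \<open>v x = g\<close>.\<close>

lemma minimal_corner_inverse:
  assumes "prime_algebra" and x: "x \<noteq> 0" "e \<cdot> x = x" "x \<cdot> g = x"
    and e: "e \<cdot> e = e" "\<And>y. \<exists>z. e \<cdot> y \<cdot> e = scaleC z e"
    and g: "g \<cdot> g = g" "\<And>y. \<exists>z. g \<cdot> y \<cdot> g = scaleC z g"
  obtains v where "g \<cdot> v = v" "v \<cdot> e = v" "x \<cdot> v = e" "v \<cdot> x = g"
proof -
  obtain y where y: "x \<cdot> y \<cdot> x \<noteq> 0" using prime_algebraD assms(1) x(1) by blast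
  obtain z where z: "e \<cdot> (x \<cdot> y) \<cdot> e = scaleC z e" using e(2) by blast
  have xye: "x \<cdot> (y \<cdot> e) = scaleC z e" using z x by (simp flip: mul_assoc)
  have xg: "x \<cdot> (g \<cdot> a) = x \<cdot> a" and ex: "e \<cdot> (x \<cdot> a) = x \<cdot> a" for a
    using x by (simp_all flip: mul_assoc)
  have "z \<noteq> 0"
  proof
    assume "z = 0"
    then have "x \<cdot> y \<cdot> e \<cdot> x = 0" using xye by (simp add: mul_assoc)
    then show False using y x by (simp add: mul_assoc)
  qed
  define v where "v = scaleC (inverse z) (g \<cdot> y \<cdot> e)"
  have v: "x \<cdot> v = e" using \<open>z \<noteq> 0\<close> xye by (simp add: v_def mul_assoc xg)
  have gv: "g \<cdot> v = v" "v \<cdot> e = v"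
    using g e by (auto simp: v_def mul_assoc simp flip: mul_assoc[of g g])
  obtain w where w: "g \<cdot> (v \<cdot> x) \<cdot> g = scaleC w g" using g(2) by blast
  have vx: "v \<cdot> x = scaleC w g" using w gv x by (simp add: mul_assoc flip: mul_assoc[of g v])
  have "x \<cdot> (v \<cdot> x) = x" using v x by (simp flip: mul_assoc)
  then have "scaleC w x = scaleC 1 x" by (simp add: vx x)
  then have "w = 1" by (simp only: scaleC_right_cancel[OF x(1)])
  then show ?thesis using that gv v vx by simp
qed

text \<open>A minimal idempotent \<open>e\<close> below \<open>g\<close> need not be self-adjoint. If \<open>y\<close> in \<open>e A g\<close> has
  \<open>w = y y\<^sup>* \<noteq> 0\<close> and \<open>v\<close> inverts \<open>w\<close>, then \<open>y\<^sup>* v y\<close> is a self-adjoint one. Such a \<open>y\<close> exists: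
  otherwise polarization would give \<open>e A g A e\<^sup>* = 0\<close>, against primeness.\<close>

lemma exists_minimal_projection:
  assumes prime: prime_algebra and g: "star g = g" "g \<cdot> g = g" "g \<noteq> 0"
  obtains p where "minimal_projection p" "g \<cdot> p = p"
proof -
  have "right_ideal_of UNIV (range ((\<cdot>) g))"
    using right_ideal_of_mul_image[of UNIV UNIV g]
    by (auto simp: right_ideal_of_def)
  moreover have "range ((\<cdot>) g) \<noteq> {0}" using g by (metis rangeI singletonD)
  ultimately obtain e where e: "e \<in> range ((\<cdot>) g)" "e \<noteq> 0" "e \<cdot> e = e"
    and inv: "\<And>x. e \<cdot> x \<cdot> e \<noteq> 0 \<Longrightarrow> \<exists>v. e \<cdot> x \<cdot> e \<cdot> v = e"
    using division_idempotent[OF prime_semiprime[OF prime]] by (metis UNIV_I)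
  have corner: "\<exists>z. e \<cdot> x \<cdot> e = scaleC z e" for x
    by (rule division_corner_scalar[OF e(2,3) inv])
  define e' where "e' = star e"
  have e': "e' \<noteq> 0" "e' \<cdot> e' = e'" using e star_mul[of e e] by (simp_all add: e'_def del: star_mul)
  have corner': "\<exists>z. e' \<cdot> x \<cdot> e' = scaleC z e'" for x
  proof -
    obtain z where "e \<cdot> star x \<cdot> e = scaleC z e" using corner by blast
    then have "star (e \<cdot> star x \<cdot> e) = scaleC (cnj z) e'" by (simp add: e'_def)
    then show ?thesis by (auto simp: e'_def mul_assoc)
  qed
  have "\<exists>b. (e \<cdot> b \<cdot> g) \<cdot> star (e \<cdot> b \<cdot> g) \<noteq> 0"
  proof (rule ccontr)
    assume "\<nexists>b. (e \<cdot> b \<cdot> g) \<cdot> star (e \<cdot> b \<cdot> g) \<noteq> 0"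
    then have zero: "(e \<cdot> b \<cdot> g) \<cdot> star (e \<cdot> b \<cdot> g) = 0" for b by blast
    define F where "F b c = (e \<cdot> b \<cdot> g) \<cdot> star (e \<cdot> c \<cdot> g)" for b c
    have sym: "F b c + F c b = 0" for b c
      using zero[of "b + c"] zero[of b] zero[of c] by (simp add: F_def algebra_simps)
    \<comment> \<open>\<open>F\<close> is linear in the first and conjugate-linear in the second
      argument, so inserting \<open>J b\<close> turns antisymmetry into symmetry.\<close>
    have "F (J b) c = J (F b c)" "F c (J b) = - J (F c b)" for b c
      by (simp_all add: F_def)
    then have "J (F b c - F c b) = 0" for b c using sym[of "J b" c] by simp
    then have "F b c = F c b" for b c using J_eq_0_iff by (metis eq_iff_diff_eq_0)
    then have "2 *\<^sub>R F b c = 0" for b c using sym[of b c] by (simp add: scaleR_2)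
    then have "F b c = 0" for b c by simp
    then have "e \<cdot> b \<cdot> (g \<cdot> star c \<cdot> e') = 0" for b c
      using g by (simp add: F_def e'_def mul_assoc flip: mul_assoc[of g g])
    then have "g \<cdot> star c \<cdot> e' = 0" for c using prime_algebraD[OF prime e(2)] by blast
    then have "g \<cdot> c \<cdot> e' = 0" for c by (metis star_star)
    then show False using prime_algebraD[OF prime g(3) e'(1)] by blast
  qed
  then obtain b where b: "(e \<cdot> b \<cdot> g) \<cdot> star (e \<cdot> b \<cdot> g) \<noteq> 0" by blast
  define y where "y = e \<cdot> b \<cdot> g"
  define w where "w = y \<cdot> star y"
  have y12: "e \<cdot> y = y" "y \<cdot> g = y"
    using e(3) g(2) by (simp_all add: y_def mul_assoc flip: mul_assoc[of e e])
  have y: "e \<cdot> y = y" "y \<cdot> g = y" "star y \<cdot> e' = star y" "g \<cdot> star y = star y"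
    using y12 by (simp_all only: e'_def) (metis star_mul, metis star_mul g(1))
  have "w \<noteq> 0" using b by (simp only: w_def y_def not_False_eq_True)
  moreover have "e \<cdot> w = w" unfolding w_def by (metis mul_assoc y(1))
  moreover have "w \<cdot> e' = w" unfolding w_def by (metis mul_assoc y(3))
  ultimately have w: "w \<noteq> 0" "star w = w" "e \<cdot> w = w" "w \<cdot> e' = w"
    by (simp_all add: w_def)
  \<comment> \<open>\<open>e\<close> and \<open>e' = star e\<close> may differ, so \<open>w\<close>
    lies in \<open>e A e'\<close> and its inverse in \<open>e' A e\<close>.\<close>
  obtain v where v: "e' \<cdot> v = v" "v \<cdot> e = v" "w \<cdot> v = e" "v \<cdot> w = e'"
    using minimal_corner_inverse[OF prime w(1,3,4) e(3) corner e'(2) corner'] by blast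
  \<comment> \<open>As \<open>w\<close> is self-adjoint, \<open>star v\<close> inverts it too, and
    inverses are unique.\<close>
  have "star v = star v \<cdot> w \<cdot> v"
    using v by (metis e'_def mul_assoc star_mul star_star)
  also have "star v \<cdot> w = e'" using v w(2) e'_def star_mul by metis
  finally have sv: "star v = v" using v by simp
  define p where "p = star y \<cdot> v \<cdot> y"
  have wv: "w \<cdot> (v \<cdot> a) = e \<cdot> a" and vw: "v \<cdot> (w \<cdot> a) = e' \<cdot> a" and ev: "e' \<cdot> (v \<cdot> a) = v \<cdot> a"
    and ysy: "y \<cdot> (star y \<cdot> a) = w \<cdot> a" for a
    using v by (simp_all add: w_def flip: mul_assoc)
  have "p \<cdot> p = p" by (simp add: p_def mul_assoc ysy wv y)
  moreover have "star p = p" by (simp add: p_def sv mul_assoc)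
  moreover have "p \<noteq> 0"
  proof
    assume "p = 0"
    then have "y \<cdot> p \<cdot> star y = 0" by simp
    moreover have "y \<cdot> p \<cdot> star y = w" 
      using w by (simp add: p_def mul_assoc ysy w_def[symmetric] vw v)
    ultimately show False using w by simp
  qed
  moreover have "\<exists>z. p \<cdot> x \<cdot> p = scaleC z p" for x
  proof -
    \<comment> \<open>In \<open>p x p = star y v (y x star y v) y\<close> the middle factor lies in
      \<open>e A e\<close>, hence is a multiple of \<open>e\<close>.\<close>
    obtain z where z: "e \<cdot> (y \<cdot> x \<cdot> star y \<cdot> v) \<cdot> e = scaleC z e" using corner by blast
    have z': "y \<cdot> (x \<cdot> (star y \<cdot> (v \<cdot> a))) = scaleC z (e \<cdot> a)" for a
    proof -
      have "y \<cdot> (x \<cdot> (star y \<cdot> (v \<cdot> a))) = e \<cdot> (y \<cdot> x \<cdot> star y \<cdot> v) \<cdot> e \<cdot> a"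
        using v(2) y(1) by (simp add: mul_assoc flip: mul_assoc[of e y] mul_assoc[of v e])
      then show ?thesis using z by simp
    qed
    have "p \<cdot> x \<cdot> p = scaleC z p" using y(1) by (simp add: p_def mul_assoc z')
    then show ?thesis by blast
  qed
  ultimately have "minimal_projection p" by (auto simp: minimal_projection_def)
  moreover have "g \<cdot> p = p" using y(4) by (simp add: p_def flip: mul_assoc)
  ultimately show ?thesis by (rule that)
qed

section \<open>Semiprimeness tested on self-adjoint elements\<close>

lemma selfadjoint_split: "2 *\<^sub>R y = (y + star y) - J (J (y - star y))"
  by (simp add: scaleR_2)

text \<open>If \<open>x A x = 0\<close>, then \<open>x s star x\<close> is self-adjoint with the
  same property for every self-adjoint \<open>s\<close>, hence zero, so
  \<open>x A star x = 0\<close>. The self-adjoint parts of \<open>x\<close> then inherit the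
  property.\<close>

lemma semiprime_selfadjointI:
  assumes "\<And>h. star h = h \<Longrightarrow> h \<cdot> h = 0 \<Longrightarrow> (\<And>y. h \<cdot> y \<cdot> h = 0) \<Longrightarrow> h = 0"
  shows "semiprime_on UNIV"
proof -
  \<comment> \<open>The square of \<open>h\<close> satisfies all hypotheses itself, so
    \<open>h h = 0\<close> need not be assumed separately.\<close>
  have sa: "h = 0" if h: "star h = h" "\<And>y. h \<cdot> y \<cdot> h = 0" for h
  proof (rule assms[OF h(1) _ h(2)])
    show "h \<cdot> h = 0"
    proof (rule assms)
      show "star (h \<cdot> h) = h \<cdot> h" using h(1) by simp
      show "h \<cdot> h \<cdot> (h \<cdot> h) = 0" using h(2)[of h] by (simp add: mul_assoc)
      show "h \<cdot> h \<cdot> y \<cdot> (h \<cdot> h) = 0" for y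
        using h(2)[of "h \<cdot> y"] by (simp flip: mul_assoc)
    qed
  qed
  have x_star: "x \<cdot> y \<cdot> star x = 0" if x: "\<And>y. x \<cdot> y \<cdot> x = 0" for x y
  proof -
    have sym: "x \<cdot> s \<cdot> star x = 0" if "star s = s" for s
    proof (rule sa)
      show "star (x \<cdot> s \<cdot> star x) = x \<cdot> s \<cdot> star x" using that by (simp add: mul_assoc)
      show "x \<cdot> s \<cdot> star x \<cdot> y \<cdot> (x \<cdot> s \<cdot> star x) = 0" for y
        using x[of "s \<cdot> star x \<cdot> y"] by (simp flip: mul_assoc)
    qed
    have "2 *\<^sub>R (x \<cdot> y \<cdot> star x) = x \<cdot> (2 *\<^sub>R y) \<cdot> star x" by simp
    also have "\<dots> = x \<cdot> (y + star y) \<cdot> star x - J (x \<cdot> J (y - star y) \<cdot> star x)"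
      unfolding selfadjoint_split by simp
    also have "x \<cdot> (y + star y) \<cdot> star x = 0" by (rule sym) (simp add: add.commute)
    also have "x \<cdot> J (y - star y) \<cdot> star x = 0" by (rule sym) simp
    finally show ?thesis by simp
  qed
  have "x = 0" if x: "\<And>y. x \<cdot> y \<cdot> x = 0" for x
  proof -
    have sx: "star x \<cdot> y \<cdot> star x = 0" for y
    proof -
      have "star (x \<cdot> star y \<cdot> x) = star 0" by (rule arg_cong[OF x])
      then show ?thesis unfolding star_mul star_star by (simp add: mul_assoc)
    qed
    have cross: "x \<cdot> y \<cdot> star x = 0" "star x \<cdot> y \<cdot> x = 0" for y
      using x_star[OF x] x_star[OF sx] by simp_all
    have p: "x + star x = 0" by (rule sa) (simp_all add: x sx cross add.commute)
    have q: "J (x - star x) = 0" by (rule sa) (simp_all add: x sx cross)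
    have "2 *\<^sub>R x = 0" unfolding selfadjoint_split[of x] p q by simp
    then show "x = 0" by simp
  qed
  then have "\<forall>x. x \<noteq> 0 \<longrightarrow> (\<exists>y. x \<cdot> y \<cdot> x \<noteq> 0)" by blast
  then show ?thesis by (simp add: semiprime_on_def)
qed

text \<open>\<open>K\<close> is the left annihilator of the left ideal generated by \<open>h\<close>, and \<open>I\<close> the right annihilator
  of \<open>K\<close> inside \<open>K\<close>; both are two-sided.\<close>

lemma square_zero_ideal:
  assumes h: "h \<cdot> h = 0" "\<And>y. h \<cdot> y \<cdot> h = 0"
  shows "\<exists>I. subspace I \<and> h \<in> I \<and> (\<forall>x\<in>I. \<forall>a. a \<cdot> x \<in> I \<and> x \<cdot> a \<in> I) \<and>
    (\<forall>x\<in>I. J x \<in> I) \<and> (\<forall>x\<in>I. \<forall>y\<in>I. x \<cdot> y = 0)"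
proof -
  define K where "K = {x. x \<cdot> h = 0 \<and> (\<forall>y. x \<cdot> y \<cdot> h = 0)}"
  define I where "I = {x \<in> K. \<forall>k\<in>K. k \<cdot> x = 0}"
  have K: "a \<cdot> x \<in> K" "x \<cdot> a \<in> K" "J x \<in> K" if "x \<in> K" for x a
  proof -
    have "x \<cdot> (a \<cdot> y) \<cdot> h = 0" "x \<cdot> a \<cdot> h = 0" for y using that by (auto simp: K_def)
    then show "a \<cdot> x \<in> K" "x \<cdot> a \<in> K" "J x \<in> K" using that by (auto simp: K_def mul_assoc)
  qed
  have "subspace K" by (auto simp: K_def subspace_def)
  show ?thesis
  proof (intro exI[of _ I] conjI ballI allI)
    show "subspace I" using \<open>subspace K\<close> by (auto simp: I_def subspace_def)
    show "h \<in> I" using h by (auto simp: I_def K_def)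
    show "x \<cdot> y = 0" if "x \<in> I" "y \<in> I" for x y using that by (auto simp: I_def)
    fix x a assume x: "x \<in> I"
    then have "k \<cdot> x = 0" "k \<cdot> a \<cdot> x = 0" if "k \<in> K" for k
      using K that by (auto simp: I_def)
    then show "a \<cdot> x \<in> I" "x \<cdot> a \<in> I" "J x \<in> I"
      using x K by (auto simp: I_def simp flip: mul_assoc)
  qed
qed

text \<open>On self-adjoint elements of the complexification this is twice the Lie product.\<close>

definition bracket :: "'c \<Rightarrow> 'c \<Rightarrow> 'c" where
  "bracket x y = J (x \<cdot> y - y \<cdot> x)"

lemma bracket_linear: "linear (bracket x)"
  by (rule linearI) (simp_all add: bracket_def algebra_simps)

end

subsection \<open>Generators of the self-adjoint part of a matrix algebra\<close>

text \<open>Applying \<open>T - \<mu> l\<close> to the sum removes \<open>v l\<close> and scales the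
  other summands by nonzero factors; induction handles these, and \<open>v l\<close> is the
  remainder.\<close>

lemma eigenvector_components_in_subspace:
  fixes T :: "'a::real_vector \<Rightarrow> 'a" and \<mu> :: "'k \<Rightarrow> real"
  assumes T: "linear T" and M: "subspace M" "\<And>m. m \<in> M \<Longrightarrow> T m \<in> M"
    and fin: "finite K"
  shows "\<lbrakk>\<And>k. k \<in> K \<Longrightarrow> T (v k) = \<mu> k *\<^sub>R v k; inj_on \<mu> K; (\<Sum>k\<in>K. v k) \<in> M; k \<in> K\<rbrakk>
    \<Longrightarrow> v k \<in> M"
  using fin
proof (induction K arbitrary: v k rule: finite_induct)
  case (insert l K)
  define s where "s = (\<Sum>k\<in>insert l K. v k)"
  have "T s - \<mu> l *\<^sub>R s = (\<Sum>k\<in>insert l K. (\<mu> k - \<mu> l) *\<^sub>R v k)"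
    using insert.prems(1)
    by (simp add: s_def linear_sum[OF T] scaleR_sum_right algebra_simps flip: sum_subtractf
        del: sum.insert)
  also have "\<dots> = (\<Sum>k\<in>K. (\<mu> k - \<mu> l) *\<^sub>R v k)" using insert.hyps by simp
  finally have "(\<Sum>k\<in>K. (\<mu> k - \<mu> l) *\<^sub>R v k) \<in> M"
    using M insert.prems(3) by (metis s_def subspace_diff subspace_scale)
  then have "(\<mu> k - \<mu> l) *\<^sub>R v k \<in> M" if "k \<in> K" for k
    using insert.IH[of "\<lambda>k. (\<mu> k - \<mu> l) *\<^sub>R v k" k] insert.prems(1,2) that
    by (simp add: linear_cmul[OF T] mult.commute)
  moreover have "\<mu> k \<noteq> \<mu> l" if "k \<in> K" for k
    using insert.prems(2) insert.hyps(2) that by (auto simp: inj_on_def)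
  ultimately have vK: "v k \<in> M" if "k \<in> K" for k
    using that subspace_scale[OF M(1), of "(\<mu> k - \<mu> l) *\<^sub>R v k" "inverse (\<mu> k - \<mu> l)"] by simp
  have "v l = s - (\<Sum>k\<in>K. v k)" using insert.hyps by (simp add: s_def)
  also have "\<dots> \<in> M" using M vK insert.prems(3) by (auto simp: s_def intro: subspace_diff subspace_sum)
  finally show ?case using vK insert.prems(4) by auto
qed simp

text \<open>For \<open>i < j\<close> the number \<open>2 ^ j - 2 ^ i\<close> lies between
  \<open>2 ^ (j - 1)\<close> and \<open>2 ^ j\<close>, the latter excluded, so it determines
  \<open>j\<close> and then \<open>i\<close>.\<close>

lemma power_2_difference_inj:
  fixes i j k l :: nat
  assumes "i < j" "k < l" and eq: "((2::real) ^ i - 2 ^ j)\<^sup>2 = (2 ^ k - 2 ^ l)\<^sup>2"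
  shows "i = k \<and> j = l"
proof -
  have less: "(2::real) ^ j - 2 ^ i < 2 ^ l - 2 ^ k" if kl: "k < l" "j < l" for i j k l :: nat
  proof -
    obtain m where m: "l = Suc m" using kl by (cases l) auto
    have "(2::real) ^ j \<le> 2 ^ m" "(2::real) ^ k \<le> 2 ^ m" using kl m by auto
    moreover have "(0::real) < 2 ^ i" by simp
    ultimately show ?thesis unfolding m power_Suc by linarith
  qed
  have pos: "(2::real) ^ i < 2 ^ j" "(2::real) ^ k < 2 ^ l" using assms by auto
  then have diff: "(2::real) ^ j - 2 ^ i = 2 ^ l - 2 ^ k"
    using eq unfolding power2_eq_iff by linarith
  then have "j = l" using less[of k l j i] less[of i j l k] assms by (cases j l rule: linorder_cases) auto
  with diff show ?thesis by simp
qed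

text \<open>The \<open>e i\<close> play the diagonal matrix units. Indexing by numbers provides the
  order on pairs and the exponents in \<open>diagonal\<close>.\<close>

locale projection_frame = involutive_algebra +
  fixes e :: "nat \<Rightarrow> 'a" and n :: nat
  assumes prime: prime_algebra
    and minimal: "i < n \<Longrightarrow> minimal_projection (e i)"
    and orthogonal: "i < n \<Longrightarrow> j < n \<Longrightarrow> i \<noteq> j \<Longrightarrow> e i \<cdot> e j = 0"
    and complete: "(\<Sum>i<n. e i) \<cdot> h = h" "h \<cdot> (\<Sum>i<n. e i) = h"
begin

lemma e_star: "i < n \<Longrightarrow> star (e i) = e i"
  and e_idem: "i < n \<Longrightarrow> e i \<cdot> e i = e i"
  and e_nonzero: "i < n \<Longrightarrow> e i \<noteq> 0"
  and e_corner: "i < n \<Longrightarrow> \<exists>z. e i \<cdot> h \<cdot> e i = scaleC z (e i)"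
  using minimal by (auto simp: minimal_projection_def)

text \<open>A multiple of an off-diagonal matrix unit when \<open>i \<noteq> j\<close>. The choices
  for different pairs are unrelated, so no multiplication table is available.\<close>

definition unit_vec :: "nat \<Rightarrow> nat \<Rightarrow> 'a" where
  "unit_vec i j = (SOME x. x \<noteq> 0 \<and> e i \<cdot> x = x \<and> x \<cdot> e j = x)"

lemma unit_vec:
  assumes "i < n" "j < n"
  shows "unit_vec i j \<noteq> 0" "e i \<cdot> unit_vec i j = unit_vec i j" "unit_vec i j \<cdot> e j = unit_vec i j"
proof -
  obtain b where "e i \<cdot> b \<cdot> e j \<noteq> 0" using prime_algebraD prime e_nonzero assms by blast
  then have "\<exists>x. x \<noteq> 0 \<and> e i \<cdot> x = x \<and> x \<cdot> e j = x"
    using e_idem assms by (intro exI[of _ "e i \<cdot> b \<cdot> e j"]) (metis mul_assoc)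
  from someI_ex[OF this, folded unit_vec_def]
  show "unit_vec i j \<noteq> 0" "e i \<cdot> unit_vec i j = unit_vec i j" "unit_vec i j \<cdot> e j = unit_vec i j"
    by auto
qed

lemma unit_vec_inverse:
  assumes "i < n" "j < n"
  obtains v where "e j \<cdot> v = v" "v \<cdot> e i = v" "unit_vec i j \<cdot> v = e i" "v \<cdot> unit_vec i j = e j"
  using minimal_corner_inverse[OF prime unit_vec[OF assms] e_idem e_corner e_idem e_corner] assms
  by metis

text \<open>Right multiplication by the inverse of \<open>unit_vec i j\<close> carries
  \<open>e i A e j\<close> into the scalar corner \<open>e i A e i\<close>.\<close>

lemma corner_unit_vec:
  assumes "i < n" "j < n"
  obtains z where "e i \<cdot> h \<cdot> e j = scaleC z (unit_vec i j)"
proof -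
  obtain v where v: "e j \<cdot> v = v" "v \<cdot> e i = v" "v \<cdot> unit_vec i j = e j"
    using unit_vec_inverse[OF assms] by metis
  obtain z where z: "e i \<cdot> (h \<cdot> v) \<cdot> e i = scaleC z (e i)" using e_corner assms by blast
  have "e i \<cdot> h \<cdot> e j = e i \<cdot> h \<cdot> (v \<cdot> e i) \<cdot> unit_vec i j"
    using v by (simp add: mul_assoc unit_vec assms)
  also have "\<dots> = scaleC z (unit_vec i j)" using z by (simp add: mul_assoc[symmetric] unit_vec assms)
  finally show ?thesis by (rule that)
qed

text \<open>For \<open>x = unit_vec i j\<close> the product \<open>x star x\<close> is a
  self-adjoint multiple of \<open>e i\<close>, so its scalar is real, and \<open>star x\<close> is
  this multiple of the inverse of \<open>x\<close>. The sign of \<open>s\<close> stays open, as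
  \<open>star\<close> is not assumed positive.\<close>

lemma unit_vec_star:
  assumes "i < n" "j < n"
  obtains s where "s \<noteq> 0" "unit_vec i j \<cdot> star (unit_vec i j) = s *\<^sub>R e i"
    "star (unit_vec i j) \<cdot> unit_vec i j = s *\<^sub>R e j"
proof -
  let ?x = "unit_vec i j"
  have sx: "e j \<cdot> star ?x = star ?x" "star ?x \<cdot> e i = star ?x"
    using unit_vec[OF assms] e_star assms by (metis star_mul)+
  obtain v where v: "e j \<cdot> v = v" "v \<cdot> e i = v" "v \<cdot> ?x = e j"
    using unit_vec_inverse[OF assms] by metis
  obtain z where "e i \<cdot> (?x \<cdot> star ?x) \<cdot> e i = scaleC z (e i)" using e_corner assms by blast
  then have z: "?x \<cdot> star ?x = scaleC z (e i)"
    using unit_vec(2)[OF assms] sx(2) by (metis mul_assoc)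
  have "star (scaleC z (e i)) = ?x \<cdot> star ?x" by (simp flip: z)
  then have "scaleC z (e i) = scaleC (cnj z) (e i)" by (simp add: z e_star assms)
  then have "z = cnj z" using scaleC_right_cancel e_nonzero assms by blast
  then obtain s where s: "z = of_real s"
    by (metis Reals_cnj_iff Reals_cases)
  have "star ?x = v \<cdot> (?x \<cdot> star ?x)" using v(3) sx(1) by (simp flip: mul_assoc)
  then have sv: "star ?x = s *\<^sub>R v" using z s v(2) by simp
  then have "s \<noteq> 0" using unit_vec(1)[OF assms] by auto
  moreover have "star ?x \<cdot> ?x = s *\<^sub>R e j" unfolding sv using v(3) by simp
  ultimately show ?thesis using that z s by simp
qed

definition re_part :: "nat \<Rightarrow> nat \<Rightarrow> 'a" where
  "re_part i j = unit_vec i j + star (unit_vec i j)"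

definition im_part :: "nat \<Rightarrow> nat \<Rightarrow> 'a" where
  "im_part i j = J (unit_vec i j - star (unit_vec i j))"

text \<open>Powers of 2 make the differences of coefficients distinct for distinct pairs
  \<open>i < j\<close>.\<close>

definition diagonal :: 'a where
  "diagonal = (\<Sum>i<n. 2 ^ i *\<^sub>R e i)"

definition index_pairs :: "(nat \<times> nat) set" where
  "index_pairs = {(i, j). i < j \<and> j < n}"

definition off_diagonal :: 'a where
  "off_diagonal = (\<Sum>(i, j)\<in>index_pairs. re_part i j)"

lemma finite_index_pairs: "finite index_pairs"
  by (rule finite_subset[of _ "{..<n} \<times> {..<n}"]) (auto simp: index_pairs_def)

lemma star_diagonal: "star diagonal = diagonal"
  by (simp add: diagonal_def star_sum e_star)

lemma star_off_diagonal: "star off_diagonal = off_diagonal"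
  by (simp add: off_diagonal_def re_part_def star_sum case_prod_beta add.commute)

lemma e_mul_unit_vec:
  assumes "i < n" "j < n" "k < n"
  shows "e k \<cdot> unit_vec i j = (if k = i then unit_vec i j else 0)"
    and "unit_vec i j \<cdot> e k = (if k = j then unit_vec i j else 0)"
proof -
  have "e k \<cdot> unit_vec i j = e k \<cdot> e i \<cdot> unit_vec i j"
    using unit_vec[OF assms(1,2)] by (simp add: mul_assoc)
  then show "e k \<cdot> unit_vec i j = (if k = i then unit_vec i j else 0)"
    using orthogonal[of k i] unit_vec[OF assms(1,2)] assms by auto
  have "unit_vec i j \<cdot> e k = unit_vec i j \<cdot> (e j \<cdot> e k)"
    using unit_vec[OF assms(1,2)] by (simp flip: mul_assoc)
  then show "unit_vec i j \<cdot> e k = (if k = j then unit_vec i j else 0)"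
    using orthogonal[of j k] unit_vec[OF assms(1,2)] assms by auto
qed

lemma diagonal_mul_unit_vec:
  assumes "i < n" "j < n"
  shows "diagonal \<cdot> unit_vec i j = 2 ^ i *\<^sub>R unit_vec i j"
    and "unit_vec i j \<cdot> diagonal = 2 ^ j *\<^sub>R unit_vec i j"
proof -
  have "diagonal \<cdot> unit_vec i j = (\<Sum>k<n. if k = i then 2 ^ i *\<^sub>R unit_vec i j else 0)"
    unfolding diagonal_def mul_sum_left by (rule sum.cong) (auto simp: e_mul_unit_vec assms)
  then show "diagonal \<cdot> unit_vec i j = 2 ^ i *\<^sub>R unit_vec i j" using assms by simp
  have "unit_vec i j \<cdot> diagonal = (\<Sum>k<n. if k = j then 2 ^ j *\<^sub>R unit_vec i j else 0)"
    unfolding diagonal_def mul_sum_right by (rule sum.cong) (auto simp: e_mul_unit_vec assms)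
  then show "unit_vec i j \<cdot> diagonal = 2 ^ j *\<^sub>R unit_vec i j" using assms by simp
qed

lemma bracket_diagonal:
  assumes "i < n" "j < n"
  shows "bracket diagonal (re_part i j) = (2 ^ i - 2 ^ j) *\<^sub>R im_part i j"
    and "bracket diagonal (im_part i j) = (2 ^ j - 2 ^ i) *\<^sub>R re_part i j"
proof -
  have "star (unit_vec i j \<cdot> diagonal) = star (2 ^ j *\<^sub>R unit_vec i j)"
    "star (diagonal \<cdot> unit_vec i j) = star (2 ^ i *\<^sub>R unit_vec i j)"
    by (simp_all only: diagonal_mul_unit_vec assms)
  then have "diagonal \<cdot> star (unit_vec i j) = 2 ^ j *\<^sub>R star (unit_vec i j)"
    "star (unit_vec i j) \<cdot> diagonal = 2 ^ i *\<^sub>R star (unit_vec i j)"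
    by (simp_all add: star_diagonal)
  then show "bracket diagonal (re_part i j) = (2 ^ i - 2 ^ j) *\<^sub>R im_part i j"
    "bracket diagonal (im_part i j) = (2 ^ j - 2 ^ i) *\<^sub>R re_part i j"
    by (simp_all add: bracket_def re_part_def im_part_def diagonal_mul_unit_vec assms algebra_simps)
qed

text \<open>For \<open>i \<noteq> j\<close> the squares of \<open>unit_vec i j\<close> and of its
  adjoint vanish, so only the two mixed products survive, and these carry the same scalar.\<close>

lemma bracket_re_im:
  assumes "i < n" "j < n" "i \<noteq> j"
  obtains s where "s \<noteq> 0" "bracket (re_part i j) (im_part i j) = s *\<^sub>R (e i - e j)"
proof -
  let ?x = "unit_vec i j"
  obtain s where s: "s \<noteq> 0" "?x \<cdot> star ?x = s *\<^sub>R e i" "star ?x \<cdot> ?x = s *\<^sub>R e j"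
    using unit_vec_star assms by metis
  have "?x \<cdot> ?x = ?x \<cdot> (e i \<cdot> ?x)" using unit_vec assms by simp
  also have "\<dots> = 0" using e_mul_unit_vec(2)[of i j i] assms by (simp flip: mul_assoc)
  finally have xx: "?x \<cdot> ?x = 0" .
  then have "star (?x \<cdot> ?x) = 0" by simp
  then have sxx: "star ?x \<cdot> star ?x = 0" by simp
  have "bracket (re_part i j) (im_part i j) = (2 * s) *\<^sub>R (e i - e j)"
    by (simp add: bracket_def re_part_def im_part_def xx sxx s algebra_simps flip: scaleR_2)
  then show ?thesis using that[of "2 * s"] s(1) by simp
qed

text \<open>\<open>ad diagonal\<close> squared acts on the \<open>(i, j)\<close> part of \<open>off_diagonal\<close> by \<open>- (2\<^sup>i - 2\<^sup>j)\<^sup>2\<close>, and these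
  eigenvalues are pairwise distinct.\<close>

lemma selfadjoint_generated:
  assumes M: "subspace M" "\<And>x y. x \<in> M \<Longrightarrow> y \<in> M \<Longrightarrow> bracket x y \<in> M"
    and a: "diagonal - \<alpha> *\<^sub>R (\<Sum>i<n. e i) \<in> M"
    and b: "off_diagonal - \<beta> *\<^sub>R (\<Sum>i<n. e i) \<in> M"
    and h: "star h = h"
  obtains m r where "m \<in> M" "h = m + r *\<^sub>R (\<Sum>i<n. e i)"
proof -
  define u where "u = (\<Sum>i<n. e i)"
  have u: "u \<cdot> x = x" "x \<cdot> u = x" for x using complete by (simp_all add: u_def)
  define T where "T x = bracket diagonal (bracket diagonal x)" for x
  \<comment> \<open>\<open>u\<close> is central, so the unknown shift of \<open>diagonal\<close> by
    \<open>\<alpha>\<close> does not affect brackets.\<close>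
  have bd: "bracket diagonal x \<in> M" if "x \<in> M" for x
  proof -
    have "bracket diagonal x = bracket (diagonal - \<alpha> *\<^sub>R u) x"
      by (simp add: bracket_def u algebra_simps)
    then show ?thesis using M(2)[OF a that] by (simp add: u_def)
  qed
  have T: "linear T" unfolding T_def
    using linear_compose[OF bracket_linear bracket_linear] by (simp add: comp_def)
  define \<mu> where "\<mu> = (\<lambda>(i, j). - ((2::real) ^ i - 2 ^ j)\<^sup>2)"
  have T_re: "T (re_part i j) = \<mu> (i, j) *\<^sub>R re_part i j" if "i < n" "j < n" for i j
  proof -
    have "T (re_part i j) = ((2 ^ i - 2 ^ j) * (2 ^ j - 2 ^ i)) *\<^sub>R re_part i j"
      by (simp only: T_def bracket_diagonal that linear_cmul[OF bracket_linear] scaleR_scaleR)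
    also have "((2::real) ^ i - 2 ^ j) * (2 ^ j - 2 ^ i) = \<mu> (i, j)"
      by (simp add: \<mu>_def power2_eq_square algebra_simps)
    finally show ?thesis .
  qed
  have inj: "inj_on \<mu> index_pairs"
    using power_2_difference_inj by (auto simp: inj_on_def \<mu>_def index_pairs_def)
  \<comment> \<open>\<open>T\<close> kills \<open>u\<close> and thereby the shift of
    \<open>off_diagonal\<close>; the eigenvectors are therefore extracted from
    \<open>T off_diagonal\<close>.\<close>
  have "T off_diagonal \<in> M"
  proof -
    have "T (off_diagonal - \<beta> *\<^sub>R u) \<in> M" using b bd by (simp add: T_def u_def)
    moreover have "T u = 0" by (simp add: T_def bracket_def u)
    ultimately show ?thesis by (simp add: linear_diff[OF T] linear_cmul[OF T])
  qed
  also have "T off_diagonal = (\<Sum>k\<in>index_pairs. \<mu> k *\<^sub>R re_part (fst k) (snd k))"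
    by (simp add: off_diagonal_def linear_sum[OF T] case_prod_beta)
      (auto simp: index_pairs_def T_re intro!: sum.cong)
  finally have sum_M: "(\<Sum>k\<in>index_pairs. \<mu> k *\<^sub>R re_part (fst k) (snd k)) \<in> M" .
  have "\<mu> (i, j) *\<^sub>R re_part (fst (i, j)) (snd (i, j)) \<in> M" if "i < j" "j < n" for i j
    by (rule eigenvector_components_in_subspace[OF T M(1) _ finite_index_pairs _ inj sum_M])
      (use that bd in \<open>auto simp: T_def[symmetric] linear_cmul[OF T] T_re index_pairs_def, auto simp: T_def\<close>)
  moreover have "\<mu> (i, j) \<noteq> 0" if "i < j" for i j using that by (simp add: \<mu>_def)
  ultimately have re: "re_part i j \<in> M" if "i < j" "j < n" for i j
    using that subspace_scale[OF M(1), of "\<mu> (i, j) *\<^sub>R re_part i j" "inverse (\<mu> (i, j))"] by auto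
  have im: "im_part i j \<in> M" if "i < j" "j < n" for i j
    using bd[OF re[OF that]] that
      subspace_scale[OF M(1), of "(2 ^ i - 2 ^ j) *\<^sub>R im_part i j" "inverse (2 ^ i - 2 ^ j)"]
    by (simp add: bracket_diagonal)
  have e_less: "e i - e j \<in> M" if ij: "i < j" "j < n" for i j
  proof -
    obtain s where s: "s \<noteq> 0" "bracket (re_part i j) (im_part i j) = s *\<^sub>R (e i - e j)"
      using bracket_re_im[of i j] ij by auto
    then have "s *\<^sub>R (e i - e j) \<in> M" using M(2)[OF re im] ij by metis
    then show ?thesis
      using subspace_scale[OF M(1), of "s *\<^sub>R (e i - e j)" "inverse s"] s(1) by simp
  qed
  have e_diff: "e i - e j \<in> M" if "i < n" "j < n" for i j
    using e_less[of i j] e_less[of j i] subspace_neg[OF M(1), of "e j - e i"] that M(1)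
    by (cases i j rule: linorder_cases) (auto simp: subspace_0)
  \<comment> \<open>\<open>N\<close> is \<open>M\<close> enlarged by the identity. It contains each
    \<open>e i\<close>, because the sum of \<open>e i - e j\<close> over all \<open>j\<close>, plus
    \<open>u\<close>, is \<open>n\<close> times \<open>e i\<close>.\<close>
  define N where "N = {m + r *\<^sub>R u | m r. m \<in> M}"
  have sN: "subspace N"
  proof -
    have "N = {x + y | x y. x \<in> M \<and> y \<in> span {u}}"
      by (auto simp: N_def span_singleton)
    then show ?thesis using subspace_sums[OF M(1), of "span {u}"] by simp
  qed
  have NI: "m + r *\<^sub>R u \<in> N" if "m \<in> M" for m r
    using that by (auto simp: N_def)
  have MN: "m \<in> N" if "m \<in> M" for m
    using NI[OF that, of 0] by simp
  have uN: "u \<in> N"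
    using NI[OF subspace_0[OF M(1)], of 1] by simp
  have eN: "e i \<in> N" if "i < n" for i
  proof -
    have "(\<Sum>j<n. e i - e j) + u \<in> N"
      using sN MN uN e_diff that by (auto intro!: subspace_add subspace_sum)
    also have "(\<Sum>j<n. e i - e j) + u = real n *\<^sub>R e i"
      by (simp add: sum_subtractf u_def sum_constant_scaleR)
    finally show ?thesis
      using subspace_scale[OF sN, of "real n *\<^sub>R e i" "inverse (real n)"] that by simp
  qed
  define g where "g i j = e i \<cdot> h \<cdot> e j" for i j
  have g_star: "star (g i j) = g j i" if "i < n" "j < n" for i j
    using that by (simp add: g_def e_star h mul_assoc)
  have off: "g i j + g j i \<in> N" if ij: "i < j" "j < n" for i j
  proof -
    obtain z where z: "g i j = scaleC z (unit_vec i j)"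
      unfolding g_def using corner_unit_vec[of i j] ij by auto
    have "g i j + g j i = Re z *\<^sub>R re_part i j + Im z *\<^sub>R im_part i j"
      using g_star[of i j, symmetric] ij
      by (simp add: z scaleC_def re_part_def im_part_def algebra_simps)
    then show ?thesis using re im ij sN MN by (auto intro!: subspace_add subspace_scale)
  qed
  have diag: "g i i \<in> N" if i: "i < n" for i
  proof -
    obtain z where z: "g i i = scaleC z (e i)" unfolding g_def using e_corner[OF i] by auto
    then have "scaleC z (e i) = scaleC (cnj z) (e i)"
      using g_star[OF i i] i by (simp add: e_star)
    then have "z = cnj z" using scaleC_right_cancel e_nonzero i by blast
    then obtain s where "z = of_real s" by (metis Reals_cnj_iff Reals_cases)
    then show ?thesis using z eN[OF i] sN by (simp add: subspace_scale)
  qed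
  have pair: "g i j + g j i \<in> N" if "i < n" "j < n" for i j
    using that off[of i j] off[of j i] diag[of i] sN
    by (cases i j rule: linorder_cases) (auto simp: add.commute subspace_add)
  have hg: "h = (\<Sum>i<n. \<Sum>j<n. g i j)"
  proof -
    have "h = (\<Sum>i<n. e i \<cdot> h) \<cdot> u" by (simp add: u flip: mul_sum_left u_def)
    also have "\<dots> = (\<Sum>i<n. e i \<cdot> h \<cdot> u)" by (rule mul_sum_left)
    finally show ?thesis by (simp only: u_def g_def mul_sum_right)
  qed
  \<comment> \<open>Doubling pairs each Peirce component \<open>g i j\<close> with its adjoint
    \<open>g j i\<close>.\<close>
  have "2 *\<^sub>R h = (\<Sum>i<n. \<Sum>j<n. g i j) + (\<Sum>j<n. \<Sum>i<n. g i j)"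
    using hg sum.swap[of g "{..<n}" "{..<n}"] by (simp add: scaleR_2)
  also have "\<dots> = (\<Sum>i<n. \<Sum>j<n. g i j + g j i)" by (simp add: sum.distrib)
  also have "\<dots> \<in> N" using sN pair by (auto intro!: subspace_sum)
  finally have "h \<in> N" using subspace_scale[OF sN, of "2 *\<^sub>R h" "1/2"] by simp
  then show ?thesis using that by (auto simp: N_def u_def)
qed

end

text \<open>Take an orthogonal family for which the right annihilator of the sum \<open>f\<close> is
  minimal. If \<open>f \<noteq> u\<close>, a minimal projection \<open>p\<close> below
  \<open>u - f\<close> extends the family; the annihilator of \<open>p + f\<close> lies in that of
  \<open>f\<close> and loses \<open>p\<close>.\<close>

lemma (in involutive_algebra) projection_frame_exists:
  assumes prime: prime_algebra and u: "\<And>x. u \<cdot> x = x" "\<And>x. x \<cdot> u = x"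
  obtains e n where "projection_frame mul J star e n" "(\<Sum>i<n. e i) = u"
proof -
  have "star u = star u \<cdot> u" using u by simp
  also have "\<dots> = star (star u \<cdot> u)" by (simp only: star_mul star_star)
  also have "\<dots> = u" using u by simp
  finally have su: "star u = u" .
  define frame where "frame E \<longleftrightarrow> finite E \<and> (\<forall>p\<in>E. minimal_projection p) \<and>
    (\<forall>p\<in>E. \<forall>q\<in>E. p \<noteq> q \<longrightarrow> p \<cdot> q = 0)" for E
  define P where "P S \<longleftrightarrow> (\<exists>E. frame E \<and> S = {x. \<Sum>E \<cdot> x = 0})" for S
  have "P {x. \<Sum>{} \<cdot> x = 0}" unfolding P_def by (rule exI[of _ "{}"]) (simp add: frame_def)
  moreover have "subspace S" if "P S" for S
    using that by (auto simp: P_def subspace_def)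
  ultimately obtain R where R: "P R" "\<And>S. P S \<Longrightarrow> S \<subseteq> R \<Longrightarrow> S = R"
    using minimal_subspace[of P] by blast
  then obtain E where E: "frame E" "R = {x. \<Sum>E \<cdot> x = 0}" by (auto simp: P_def)
  define f where "f = \<Sum>E"
  have prod: "p \<cdot> q = (if q = p then p else 0)" "q \<cdot> p = (if q = p then p else 0)"
    if "p \<in> E" "q \<in> E" for p q
    using E(1) that by (auto simp: frame_def minimal_projection_def)
  have "finite E" using E(1) by (simp add: frame_def)
  have absorb: "p \<cdot> f = p" "f \<cdot> p = p" if "p \<in> E" for p
    by (simp_all add: f_def mul_sum_left mul_sum_right prod that \<open>finite E\<close> cong: sum.cong)
  have ff: "f \<cdot> f = f"
  proof -
    have "f \<cdot> f = (\<Sum>p\<in>E. p \<cdot> f)" by (simp add: f_def mul_sum_left)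
    also have "\<dots> = f" using absorb by (simp add: f_def)
    finally show ?thesis .
  qed
  have sf: "star f = f"
    using E(1) by (simp add: f_def star_sum frame_def minimal_projection_def)
  have "f = u"
  proof (rule ccontr)
    assume "f \<noteq> u"
    define g where "g = u - f"
    have g: "star g = g" "g \<cdot> g = g" "g \<noteq> 0"
      using su sf ff u \<open>f \<noteq> u\<close> by (auto simp: g_def)
    obtain p where p: "minimal_projection p" "g \<cdot> p = p"
      using exists_minimal_projection[OF prime g] by blast
    have pp: "p \<noteq> 0" "p \<cdot> p = p" "star p = p" using p by (auto simp: minimal_projection_def)
    have fp: "f \<cdot> p = 0" using p(2) u by (simp add: g_def)
    then have "star (f \<cdot> p) = 0" by simp
    then have pf: "p \<cdot> f = 0" using sf pp by simp
    have "q \<cdot> p = 0" "p \<cdot> q = 0" if "q \<in> E" for q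
    proof -
      have "q \<cdot> p = q \<cdot> f \<cdot> p" using absorb that by simp
      then show "q \<cdot> p = 0" using fp by (simp add: mul_assoc)
      have "p \<cdot> q = p \<cdot> f \<cdot> q" using absorb that by (simp add: mul_assoc)
      then show "p \<cdot> q = 0" using pf by simp
    qed
    then have "frame (insert p E)" using E(1) p(1) by (auto simp: frame_def)
    moreover have "p \<notin> E" using absorb fp pp by metis
    then have sum_insert: "\<Sum>(insert p E) = p + f" using E(1) by (simp add: f_def frame_def)
    ultimately have "P {x. (p + f) \<cdot> x = 0}" unfolding P_def by metis
    moreover have "{x. (p + f) \<cdot> x = 0} \<subseteq> R"
    proof safe
      fix x assume "(p + f) \<cdot> x = 0"
      then have "f \<cdot> ((p + f) \<cdot> x) = 0" by simp
      then have "(f \<cdot> p + f \<cdot> f) \<cdot> x = 0" by (simp add: mul_assoc)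
      then show "x \<in> R" using E(2) fp ff by (simp add: f_def)
    qed
    ultimately have "{x. (p + f) \<cdot> x = 0} = R" by (rule R(2))
    moreover have "p \<in> R" using fp E(2) by (simp add: f_def)
    ultimately have "(p + f) \<cdot> p = 0" by blast
    then show False using pp fp by simp
  qed
  obtain e where e: "bij_betw e {..<card E} E"
    using ex_bij_betw_nat_finite[of E] E(1) by (auto simp: frame_def atLeast0LessThan)
  then have sum: "(\<Sum>i<card E. e i) = u"
    using sum.reindex_bij_betw[OF e, of "\<lambda>p. p"] \<open>f = u\<close> by (simp add: f_def)
  have "projection_frame mul J star e (card E)"
  proof unfold_locales
    show prime_algebra by (rule prime)
    fix i j h assume i: "i < card E"
    then have "e i \<in> E" using e by (auto simp: bij_betw_def)
    then show "minimal_projection (e i)" using E(1) by (auto simp: frame_def)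
    assume "j < card E" "i \<noteq> j"
    then have "e j \<in> E" "e i \<noteq> e j" using e i by (auto simp: bij_betw_def inj_on_def)
    then show "e i \<cdot> e j = 0" using E(1) \<open>e i \<in> E\<close> by (auto simp: frame_def)
  qed (simp_all add: sum u)
  then show ?thesis using that sum by blast
qed

subsection \<open>Lie-Jordan algebras\<close>

lemma minus_eq_self_imp_zero:
  fixes b :: "'a::real_vector"
  assumes "- b = b"
  shows "b = 0"
proof -
  have "2 *\<^sub>R b = b - (- b)" by (simp add: scaleR_2)
  then show ?thesis by (simp add: assms)
qed

lemma span_closed_linear:
  assumes "linear f" "\<And>x. x \<in> X \<Longrightarrow> f x \<in> span Y" "x \<in> span X"
  shows "f x \<in> span Y"
proof -
  have "f ` span X = span (f ` X)" using assms(1) by (rule linear_span_image[symmetric])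
  also have "\<dots> \<subseteq> span Y" using assms(2) by (intro span_minimal) auto
  finally show ?thesis using assms(3) by blast
qed

lemma span_closed_bilinear:
  assumes prd: "bilinear prd" and X: "\<And>x y. x \<in> X \<Longrightarrow> y \<in> X \<Longrightarrow> prd x y \<in> span X"
    and xy: "x \<in> span X" "y \<in> span X"
  shows "prd x y \<in> span X"
proof -
  have lin: "linear (prd x)" "linear (\<lambda>x. prd x y)" for x y
    using prd by (auto simp: bilinear_def)
  have "prd x y \<in> span X" if "x \<in> X" for x
    by (rule span_closed_linear[OF lin(1) X xy(2)]) (use that in auto)
  then show ?thesis by (rule span_closed_linear[OF lin(2) _ xy(1)])
qed

lemma span_iterated_products_closed:
  assumes "bilinear prd" "x \<in> span (iterated_products prd G)" "y \<in> span (iterated_products prd G)"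
  shows "prd x y \<in> span (iterated_products prd G)"
  using span_closed_bilinear[OF assms(1) _ assms(2,3)]
  by (simp add: iterated_products.product span_base)

section \<open>Right-normed Lie words and Jordan-closed subspaces\<close>

inductive_set right_normed_products :: "('a \<Rightarrow> 'a \<Rightarrow> 'a) \<Rightarrow> 'a set \<Rightarrow> 'a set"
  for prd :: "'a \<Rightarrow> 'a \<Rightarrow> 'a" and G :: "'a set" where
  generator: "x \<in> G \<Longrightarrow> x \<in> right_normed_products prd G"
| product: "x \<in> G \<Longrightarrow> y \<in> right_normed_products prd G \<Longrightarrow> prd x y \<in> right_normed_products prd G"

context real_lie_algebra
begin

lemmas lie_simps [simp] =
  bilinear_ladd[OF lie_bilinear] bilinear_radd[OF lie_bilinear]
  bilinear_lmul[OF lie_bilinear] bilinear_rmul[OF lie_bilinear]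
  bilinear_lneg[OF lie_bilinear] bilinear_rneg[OF lie_bilinear]
  bilinear_lsub[OF lie_bilinear] bilinear_rsub[OF lie_bilinear]
  bilinear_lzero[OF lie_bilinear] bilinear_rzero[OF lie_bilinear]

lemma lie_self [simp]: "lie a a = 0"
  by (rule minus_eq_self_imp_zero) (rule lie_antisym[symmetric])

lemma lie_right: "linear (lie x)"
  using lie_bilinear by (simp add: bilinear_def)

lemma lie_lie_left: "lie (lie g w) y = lie g (lie w y) - lie w (lie g y)"
proof -
  have "lie (lie g w) y = - lie (lie y g) w - lie (lie w y) g"
    using lie_jacobi[of g w y] by (simp add: algebra_simps eq_neg_iff_add_eq_0)
  also have "lie (lie y g) w = lie w (lie g y)"
    using lie_antisym[of "lie y g" w] lie_antisym[of y g] by simp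
  also have "lie (lie w y) g = - lie g (lie w y)" by (rule lie_antisym)
  finally show ?thesis by simp
qed

text \<open>By Jacobi, bracketing with \<open>[g, w]\<close> is the commutator of bracketing with
  \<open>g\<close> and with \<open>w\<close>. Induction on the left factor, for every right factor
  in the span, closes the span under brackets.\<close>

lemma iterated_products_right_normed:
  "x \<in> iterated_products lie G \<Longrightarrow> x \<in> span (right_normed_products lie G)"
proof (induction rule: iterated_products.induct)
  case (generator x)
  then show ?case by (intro span_base right_normed_products.generator)
next
  case (product x y)
  have "lie x y \<in> span (right_normed_products lie G)"
    if "x \<in> right_normed_products lie G" "y \<in> span (right_normed_products lie G)" for x y
    using that
  proof (induction arbitrary: y rule: right_normed_products.induct)
    case (generator g)
    then show ?case
      by (intro span_closed_linear[OF lie_right _ generator(2)] span_base right_normed_products.product)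
  next
    case (product g w)
    have "lie g z \<in> span (right_normed_products lie G)"
      if "z \<in> span (right_normed_products lie G)" for z
      using product.hyps(1)
      by (intro span_closed_linear[OF lie_right _ that] span_base right_normed_products.product)
    then show ?case
      unfolding lie_lie_left using product by (intro span_diff) auto
  qed
  then show ?case
    using span_closed_bilinear[OF lie_bilinear _ product.IH] span_base by blast
qed

end

context lie_jordan_algebra
begin

lemmas jordan_simps [simp] =
  bilinear_ladd[OF jordan_bilinear] bilinear_radd[OF jordan_bilinear]
  bilinear_lmul[OF jordan_bilinear] bilinear_rmul[OF jordan_bilinear]
  bilinear_lneg[OF jordan_bilinear] bilinear_rneg[OF jordan_bilinear]
  bilinear_lsub[OF jordan_bilinear] bilinear_rsub[OF jordan_bilinear]
  bilinear_lzero[OF jordan_bilinear] bilinear_rzero[OF jordan_bilinear]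

text \<open>By the associator identity a Jordan-closed subspace is closed under double brackets. A
  right-normed bracket of \<open>a\<close> and \<open>b\<close> is a chain of double brackets that starts from \<open>a\<close>, \<open>b\<close>
  (odd length) or \<open>[a, b]\<close> (even length).\<close>

lemma jordan_closed_contains_lie_products:
  assumes S: "subspace S" "\<And>x y. x \<in> S \<Longrightarrow> y \<in> S \<Longrightarrow> jordan x y \<in> S"
    and ab: "a \<in> S" "b \<in> S" "lie a b \<in> S"
  shows "span (iterated_products lie {a, b}) \<subseteq> S"
proof -
  have double: "lie x (lie y z) \<in> S" if "x \<in> S" "y \<in> S" "z \<in> S" for x y z
    using S that by (auto simp flip: associator intro!: subspace_diff)
  have "lie b a \<in> S" using ab(3) S(1) lie_antisym[of b a] by (simp add: subspace_neg)
  \<comment> \<open>A double bracket prepends two letters at once, so the induction also carries the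
    words with one letter prepended.\<close>
  have words: "w \<in> S \<and> lie a w \<in> S \<and> lie b w \<in> S" if "w \<in> right_normed_products lie {a, b}" for w
    using that
  proof (induction rule: right_normed_products.induct)
    case (generator x)
    then show ?case using ab \<open>lie b a \<in> S\<close> subspace_0[OF S(1)] by auto
  next
    case (product x y)
    then show ?case using ab double by auto
  qed
  have "span (right_normed_products lie {a, b}) \<subseteq> S"
    using words S(1) by (intro span_minimal) auto
  then have "iterated_products lie {a, b} \<subseteq> S"
    using iterated_products_right_normed by blast
  then show ?thesis using S(1) by (rule span_minimal)
qed

section \<open>The complexification\<close>

text \<open>The pair \<open>(a, b)\<close> stands for \<open>a + i b\<close>, and the product is determined by
  \<open>x y = x \<circ> y - i [x, y]\<close> for \<open>x\<close> and \<open>y\<close> in the Lie-Jordan algebra.\<close>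

definition cmul :: "'a \<times> 'a \<Rightarrow> 'a \<times> 'a \<Rightarrow> 'a \<times> 'a" where
  "cmul x y =
    (jordan (fst x) (fst y) - jordan (snd x) (snd y) + lie (fst x) (snd y) + lie (snd x) (fst y),
     jordan (fst x) (snd y) + jordan (snd x) (fst y) - lie (fst x) (fst y) + lie (snd x) (snd y))"

definition cJ :: "'a \<times> 'a \<Rightarrow> 'a \<times> 'a" where
  "cJ x = (- snd x, fst x)"

definition cstar :: "'a \<times> 'a \<Rightarrow> 'a \<times> 'a" where
  "cstar x = (fst x, - snd x)"

text \<open>The real part of \<open>(a b) c = a (b c)\<close> in the complexification; it combines
  the associator and Jacobi identities.\<close>

lemma associator_lie: "jordan (jordan a b) c - lie (lie a b) c = jordan a (jordan b c) - lie a (lie b c)"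
proof -
  have "lie b (lie c a) = lie (lie a b) c - lie a (lie b c)"
    using lie_lie_left[of a b c] lie_antisym[of c a] by simp
  then have "jordan (jordan a b) c - jordan a (jordan b c) = lie (lie a b) c - lie a (lie b c)"
    using associator[of a b c] by simp
  moreover have "p - r = q - s" if "p - q = r - s" for p q r s :: 'a
  proof -
    have "p = r - s + q" using that by (simp only: diff_eq_eq)
    then show ?thesis by simp
  qed
  ultimately show ?thesis by blast
qed

text \<open>The imaginary part of the same law, from the Leibniz rule for \<open>c\<close> acting on
  \<open>jordan a b\<close> and for \<open>a\<close> acting on \<open>jordan b c\<close>.\<close>

lemma leibniz_mixed: "jordan (lie a b) c + lie (jordan a b) c = jordan a (lie b c) + lie a (jordan b c)"
proof -
  have "lie (jordan a b) c = jordan (lie a c) b + jordan a (lie b c)"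
    using leibniz[of c a b] by (simp add: lie_antisym[of "jordan a b" c] lie_antisym[of c a] lie_antisym[of c b])
  then show ?thesis using leibniz[of a b c] jordan_sym[of b "lie a c"] by simp
qed

lemma involutive_algebra_complexification:
  assumes B: "finite B" "span B = (UNIV :: 'a set)"
  shows "involutive_algebra cmul cJ cstar"
proof (rule involutive_algebra.intro)
  show "bilinear cmul"
    unfolding bilinear_def
    by (auto intro!: linearI simp: cmul_def algebra_simps)
  show "cmul (cmul x y) z = cmul x (cmul y z)" for x y z
  proof -
    obtain a a' b b' c c' where [simp]: "x = (a, a')" "y = (b, b')" "z = (c, c')"
      by (metis surj_pair)
    \<comment> \<open>By trilinearity each component of \<open>(x y) z\<close> is a signed sum of
      left sides for these eight triples; the right sides add up to \<open>x (y z)\<close>.\<close>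
    note A = associator_lie[of a b c] associator_lie[of a b c'] associator_lie[of a b' c]
      associator_lie[of a b' c'] associator_lie[of a' b c] associator_lie[of a' b c']
      associator_lie[of a' b' c] associator_lie[of a' b' c']
    note L = leibniz_mixed[of a b c] leibniz_mixed[of a b c'] leibniz_mixed[of a b' c]
      leibniz_mixed[of a b' c'] leibniz_mixed[of a' b c] leibniz_mixed[of a' b c']
      leibniz_mixed[of a' b' c] leibniz_mixed[of a' b' c']
    have "fst (cmul (cmul x y) z) = fst (cmul x (cmul y z))"
    proof -
      have "fst (cmul (cmul x y) z) =
          (jordan (jordan a b) c - lie (lie a b) c)
          - (jordan (jordan a b') c' - lie (lie a b') c')
          - (jordan (jordan a' b) c' - lie (lie a' b) c')
          - (jordan (jordan a' b') c - lie (lie a' b') c)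
          + (jordan (lie a b) c' + lie (jordan a b) c')
          + (jordan (lie a b') c + lie (jordan a b') c)
          + (jordan (lie a' b) c + lie (jordan a' b) c)
          - (jordan (lie a' b') c' + lie (jordan a' b') c')"
        by (simp add: cmul_def)
      then show ?thesis unfolding A L by (simp add: cmul_def)
    qed
    moreover have "snd (cmul (cmul x y) z) = snd (cmul x (cmul y z))"
    proof -
      have "snd (cmul (cmul x y) z) =
          (jordan (jordan a b) c' - lie (lie a b) c')
          + (jordan (jordan a b') c - lie (lie a b') c)
          + (jordan (jordan a' b) c - lie (lie a' b) c)
          - (jordan (jordan a' b') c' - lie (lie a' b') c')
          - (jordan (lie a b) c + lie (jordan a b) c)
          + (jordan (lie a b') c' + lie (jordan a b') c')
          + (jordan (lie a' b) c' + lie (jordan a' b) c')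
          + (jordan (lie a' b') c + lie (jordan a' b') c)"
        by (simp add: cmul_def)
      then show ?thesis unfolding A L by (simp add: cmul_def)
    qed
    ultimately show ?thesis by (rule prod_eqI)
  qed
  show "linear cJ" "linear cstar"
    by (auto intro!: linearI simp: cJ_def cstar_def)
  show "cstar (cmul x y) = cmul (cstar y) (cstar x)" for x y
    by (simp add: cstar_def cmul_def jordan_sym[of "fst y"] jordan_sym[of "snd y"]
        lie_antisym[of "fst y" "fst x"] lie_antisym[of "fst y" "snd x"]
        lie_antisym[of "snd y" "fst x"] lie_antisym[of "snd y" "snd x"])
  have inl: "linear (\<lambda>x::'a. (x, 0::'a))" and inr: "linear (\<lambda>x::'a. (0::'a, x))"
    by (auto intro!: linearI)
  define C where "C = (\<lambda>x::'a. (x, 0::'a)) ` B \<union> (\<lambda>x::'a. (0::'a, x)) ` B"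
  have "(x, y) \<in> span C" for x y
  proof -
    have "(x, 0) \<in> span C" "(0, y) \<in> span C"
      using span_closed_linear[OF inl, of B C x] span_closed_linear[OF inr, of B C y] B
      by (auto simp: C_def intro: span_base)
    then have "(x, 0) + (0, y) \<in> span C" by (rule span_add)
    then show ?thesis by simp
  qed
  then have "span C = UNIV" by auto
  moreover have "finite C" using B by (simp add: C_def)
  ultimately show "\<exists>B::('a \<times> 'a) set. finite B \<and> span B = UNIV" by blast
qed (auto simp: cmul_def cJ_def cstar_def algebra_simps)

section \<open>Abelian Lie ideals and semisimplicity\<close>

definition abelian_ideal :: "'a set \<Rightarrow> bool" where
  "abelian_ideal I \<longleftrightarrow> subspace I \<and> (\<forall>x. \<forall>y\<in>I. lie x y \<in> I) \<and> (\<forall>x\<in>I. \<forall>y\<in>I. lie x y = 0)"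

lemma cmul_real: "cmul (x, 0) (y, 0) = (jordan x y, - lie x y)"
  by (simp add: cmul_def)

lemma cstar_fixed: "cstar h = h \<longleftrightarrow> h = (fst h, 0)"
  by (cases h) (auto simp: cstar_def dest: minus_eq_self_imp_zero)

text \<open>A self-adjoint \<open>h\<close> with \<open>h A h = 0\<close> and \<open>h h = 0\<close>
  lies in a square-zero ideal, whose real elements form an abelian Lie ideal, hence lie in
  \<open>Z\<close>. Later \<open>Z\<close> is \<open>{0}\<close> or \<open>span {u}\<close>.\<close>

lemma semiprime_complexification:
  assumes B: "finite B" "span B = (UNIV :: 'a set)"
    and ideals: "\<And>I. abelian_ideal I \<Longrightarrow> I \<subseteq> Z"
    and nil: "\<And>h. h \<in> Z \<Longrightarrow> jordan h h = 0 \<Longrightarrow> h = 0"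
  shows "involutive_algebra.semiprime_on cmul UNIV"
proof -
  interpret A: involutive_algebra cmul cJ cstar
    by (rule involutive_algebra_complexification[OF B])
  show ?thesis
  proof (rule A.semiprime_selfadjointI)
    fix h assume h: "cstar h = h" "cmul h h = 0" "\<And>y. cmul (cmul h y) h = 0"
    obtain I where I: "subspace I" "h \<in> I"
      "\<And>x a. x \<in> I \<Longrightarrow> cmul a x \<in> I" "\<And>x a. x \<in> I \<Longrightarrow> cmul x a \<in> I"
      "\<And>x. x \<in> I \<Longrightarrow> cJ x \<in> I" "\<And>x y. x \<in> I \<Longrightarrow> y \<in> I \<Longrightarrow> cmul x y = 0"
      using A.square_zero_ideal[OF h(2,3)] by blast
    define N where "N = {a. (a, 0) \<in> I}"
    have "subspace N"
      unfolding subspace_def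
    proof (intro conjI ballI allI)
      show "0 \<in> N" using subspace_0[OF I(1)] by (simp add: N_def zero_prod_def)
      show "x + y \<in> N" if "x \<in> N" "y \<in> N" for x y
        using subspace_add[OF I(1), of "(x, 0)" "(y, 0)"] that by (simp add: N_def)
      show "c *\<^sub>R x \<in> N" if "x \<in> N" for c x
        using subspace_scale[OF I(1), of "(x, 0)" c] that by (simp add: N_def)
    qed
    moreover have "lie x a \<in> N" if "a \<in> N" for x a
    proof -
      have "(1/2) *\<^sub>R cJ (cmul (x, 0) (a, 0) - cmul (a, 0) (x, 0)) \<in> I"
        using that I by (simp add: N_def subspace_scale subspace_diff)
      also have "(1/2) *\<^sub>R cJ (cmul (x, 0) (a, 0) - cmul (a, 0) (x, 0)) = (lie x a, 0)"
        by (simp add: cmul_real cJ_def jordan_sym[of a x] lie_antisym[of a x] flip: scaleR_2)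
      finally show ?thesis by (simp add: N_def)
    qed
    moreover have "lie x a = 0" if "x \<in> N" "a \<in> N" for x a
      using I(6)[of "(x, 0)" "(a, 0)"] that by (simp add: N_def cmul_real zero_prod_def)
    ultimately have "N \<subseteq> Z" by (intro ideals) (simp add: abelian_ideal_def)
    moreover have "fst h \<in> N" using I(2) h(1) by (simp add: N_def cstar_fixed)
    moreover have "jordan (fst h) (fst h) = 0"
    proof -
      have "cmul (fst h, 0) (fst h, 0) = 0" using h(1,2) cstar_fixed by metis
      then show ?thesis by (simp add: cmul_real zero_prod_def)
    qed
    ultimately have "fst h = 0" using nil by blast
    then show "h = 0" using h(1) by (simp add: cstar_fixed zero_prod_def)
  qed
qed

text \<open>A central self-adjoint element has zero bracket with everything, so its span is an
  abelian ideal.\<close>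

lemma central_in:
  assumes ideals: "\<And>I. abelian_ideal I \<Longrightarrow> I \<subseteq> Z"
    and h: "cstar h = h" "\<And>x. cmul h x = cmul x h"
  shows "fst h \<in> Z" "h = (fst h, 0)"
proof -
  show h0: "h = (fst h, 0)" using h(1) by (simp add: cstar_fixed)
  have "lie x (fst h) = 0" for x
  proof -
    have "lie x (fst h) = lie (fst h) x"
      using h(2)[of "(x, 0)"] by (subst (asm) (1 2) h0) (simp add: cmul_real)
    then show ?thesis using lie_antisym[of "fst h" x] by (intro minus_eq_self_imp_zero) simp
  qed
  then have "lie x y = 0" if "y \<in> span {fst h}" for x y
    using that by (auto simp: span_singleton)
  then have "abelian_ideal (span {fst h})"
    by (simp add: abelian_ideal_def span_0)
  then show "fst h \<in> Z" using ideals span_base[of "fst h" "{fst h}"] by blast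
qed

lemma abelian_ideal_solvable: "abelian_ideal I \<Longrightarrow> lie_solvable lie I"
  unfolding lie_solvable_def
proof (rule exI[of _ 1])
  assume I: "abelian_ideal I"
  then have "0 \<in> I" by (simp add: abelian_ideal_def subspace_0)
  then have "{lie x y |x y. x \<in> I \<and> y \<in> I} = {0}"
    using I by (auto simp: abelian_ideal_def) (metis lie_simps(9))
  then show "(lie_derived lie ^^ 1) I = {0}" by (simp add: lie_derived_def)
qed

text \<open>The identity element of the complexification would span an abelian ideal.\<close>

lemma semisimple_nonunital_trivial:
  assumes "semisimple_lie lie UNIV"
  shows "(x :: 'a) = 0"
proof -
  obtain B :: "'a set" where B: "finite B" "span B = UNIV"
    using assms by (auto simp: semisimple_lie_def)
  interpret A: involutive_algebra cmul cJ cstar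
    by (rule involutive_algebra_complexification[OF B])
  have ideals: "I \<subseteq> {0}" if "abelian_ideal I" for I
    using assms abelian_ideal_solvable[OF that] that
    by (auto simp: semisimple_lie_def lie_ideal_def abelian_ideal_def)
  have "A.semiprime_on UNIV" by (rule semiprime_complexification[OF B ideals]) simp_all
  then obtain f where f: "\<And>x. cmul f x = x" "\<And>x. cmul x f = x"
    using A.semiprime_on_identity by (metis UNIV_I)
  have "cstar f = cmul (cstar f) f" using f by simp
  also have "\<dots> = cstar (cmul (cstar f) f)" by (simp only: A.star_mul A.star_star)
  also have "\<dots> = f" using f by simp
  finally have "fst f \<in> {0}" "f = (fst f, 0)"
    using central_in[OF ideals, of f] f by simp_all
  then have "f = 0" by (metis singletonD zero_prod_def)
  then have "(x, 0::'a) = 0" using f(1)[of "(x, 0)"] by simp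
  then show ?thesis by (simp add: zero_prod_def)
qed

text \<open>The Leibniz rule on \<open>jordan u u = u\<close> gives
  \<open>[x, u] = 2 [x, u]\<close>.\<close>

lemma lie_unit:
  assumes "jordan_unit jordan u"
  shows "lie x u = 0" "lie u x = 0"
proof -
  have u: "jordan u a = a" "jordan a u = a" for a
    using assms jordan_sym[of a u] by (simp_all add: jordan_unit_def)
  show "lie x u = 0" using leibniz[of x u u] by (simp add: u)
  then show "lie u x = 0" using lie_antisym[of u x] by simp
qed

text \<open>As \<open>u\<close> is Lie-central, the projection \<open>I0\<close> of \<open>I\<close>
  to \<open>L0\<close> along \<open>u\<close> is an abelian ideal of \<open>L0\<close>, hence
  zero.\<close>

lemma unital_abelian_ideal:
  assumes ss: "unital_semisimple jordan lie u L0" and I: "abelian_ideal I"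
  shows "I \<subseteq> span {u}"
proof -
  have unit: "jordan_unit jordan u" and sub: "lie_subalgebra lie L0"
    and rad: "\<And>I. lie_ideal lie L0 I \<Longrightarrow> lie_solvable lie I \<Longrightarrow> I = {0}"
    and dec: "\<And>x. \<exists>r. \<exists>y\<in>L0. x = r *\<^sub>R u + y"
    using ss unfolding unital_semisimple_def semisimple_lie_def by blast+
  have sL: "subspace L0" using sub by (simp add: lie_subalgebra_def)
  have sI: "subspace I" and Il: "\<And>x y. y \<in> I \<Longrightarrow> lie x y \<in> I"
    and Ia: "\<And>x y. x \<in> I \<Longrightarrow> y \<in> I \<Longrightarrow> lie x y = 0"
    using I by (auto simp: abelian_ideal_def)
  define I0 where "I0 = {y \<in> L0. \<exists>r. r *\<^sub>R u + y \<in> I}"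
  have "subspace I0"
    unfolding subspace_def
  proof (intro conjI ballI allI)
    show "0 \<in> I0" using subspace_0[OF sL] subspace_0[OF sI] by (auto simp: I0_def intro: exI[of _ 0])
    show "x + y \<in> I0" if xy: "x \<in> I0" "y \<in> I0" for x y
    proof -
      obtain r s where "r *\<^sub>R u + x \<in> I" "s *\<^sub>R u + y \<in> I" using xy by (auto simp: I0_def)
      then have "(r *\<^sub>R u + x) + (s *\<^sub>R u + y) \<in> I" using sI by (rule_tac subspace_add)
      then have "(r + s) *\<^sub>R u + (x + y) \<in> I" by (simp add: algebra_simps)
      then show ?thesis using xy sL by (auto simp: I0_def subspace_add)
    qed
    show "c *\<^sub>R x \<in> I0" if x: "x \<in> I0" for c x
    proof -
      obtain r where "r *\<^sub>R u + x \<in> I" using x by (auto simp: I0_def)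
      then have "c *\<^sub>R (r *\<^sub>R u + x) \<in> I" using sI by (rule_tac subspace_scale)
      then have "(c * r) *\<^sub>R u + c *\<^sub>R x \<in> I" by (simp add: scaleR_add_right)
      then show ?thesis using x sL by (auto simp: I0_def subspace_scale)
    qed
  qed
  have lie_shift: "lie (r *\<^sub>R u + x) (s *\<^sub>R u + y) = lie x y" for r s x y
    by (simp add: lie_unit[OF unit])
  have "lie_ideal lie L0 I0"
    unfolding lie_ideal_def
  proof (intro conjI ballI \<open>subspace I0\<close>)
    fix x y assume x: "x \<in> L0" and y: "y \<in> I0"
    then obtain r where "r *\<^sub>R u + y \<in> I" by (auto simp: I0_def)
    then have "lie x y \<in> I" using Il[of "r *\<^sub>R u + y" x] by (simp add: lie_unit[OF unit])
    then have "0 *\<^sub>R u + lie x y \<in> I" by simp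
    then show "lie x y \<in> I0"
      using x y sub unfolding I0_def lie_subalgebra_def by blast
  qed (auto simp: I0_def)
  moreover have "lie x y = 0" if xy: "x \<in> I0" "y \<in> I0" for x y
  proof -
    obtain r s where "r *\<^sub>R u + x \<in> I" "s *\<^sub>R u + y \<in> I" using xy by (auto simp: I0_def)
    then show ?thesis using Ia lie_shift by metis
  qed
  then have "{lie x y |x y. x \<in> I0 \<and> y \<in> I0} = {0}"
    using subspace_0[OF \<open>subspace I0\<close>] by auto (metis lie_simps(9))
  then have "lie_solvable lie I0"
    unfolding lie_solvable_def by (intro exI[of _ 1]) (simp add: lie_derived_def)
  ultimately have "I0 = {0}" by (rule rad)
  show ?thesis
  proof
    fix x assume x: "x \<in> I"
    obtain r y where y: "y \<in> L0" "x = r *\<^sub>R u + y" using dec by blast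
    then have "y \<in> I0" using x by (auto simp: I0_def)
    then show "x \<in> span {u}" using y \<open>I0 = {0}\<close> by (auto simp: span_singleton)
  qed
qed

text \<open>The Lie algebra \<open>W\<close> generated by \<open>a\<close> and \<open>b\<close>,
  embedded as \<open>M\<close>, yields together with \<open>u\<close> all self-adjoint elements of
  the complexification, that is, the whole Lie-Jordan algebra.\<close>

lemma unital_two_generators:
  assumes ss: "unital_semisimple jordan lie u L0"
  obtains a b where "a \<in> L0" "b \<in> L0" "generates lie {a, b} L0"
proof -
  have unit: "jordan_unit jordan u" and sub: "lie_subalgebra lie L0"
    and inter: "span {u} \<inter> L0 = {0}" and dec: "\<And>x. \<exists>r. \<exists>y\<in>L0. x = r *\<^sub>R u + y"
    and fin: "\<exists>B. finite B \<and> L0 = span B"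
    using ss unfolding unital_semisimple_def semisimple_lie_def by blast+
  have sL: "subspace L0" and lL: "\<And>x y. x \<in> L0 \<Longrightarrow> y \<in> L0 \<Longrightarrow> lie x y \<in> L0"
    using sub by (auto simp: lie_subalgebra_def)
  obtain B0 where B0: "finite B0" "L0 = span B0" using fin by blast
  have "x \<in> span (insert u B0)" for x
  proof -
    obtain r y where "y \<in> L0" "x = r *\<^sub>R u + y" using dec by blast
    then show ?thesis using B0(2) span_breakdown_eq[of x u B0] by (auto intro!: exI[of _ r])
  qed
  then have B: "finite (insert u B0)" "span (insert u B0) = UNIV" using B0 by auto
  interpret A: involutive_algebra cmul cJ cstar
    by (rule involutive_algebra_complexification[OF B])
  have ju: "jordan u a = a" "jordan a u = a" for a
    using unit jordan_sym[of a u] by (simp_all add: jordan_unit_def)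
  have cu: "cmul (u, 0) x = x" "cmul x (u, 0) = x" for x
    by (simp_all add: cmul_def ju lie_unit[OF unit])
  have ideals: "I \<subseteq> span {u}" if "abelian_ideal I" for I
    by (rule unital_abelian_ideal[OF ss that])
  have "A.semiprime_on UNIV"
  proof (rule semiprime_complexification[OF B ideals])
    fix h assume "h \<in> span {u}" "jordan h h = 0"
    then show "h = 0" by (auto simp: span_singleton ju)
  qed
  then have "A.prime_algebra"
  proof (rule A.prime_algebraI[OF _ cu])
    fix h assume "cstar h = h" "\<And>x. cmul h x = cmul x h"
    from central_in[OF ideals this] show "\<exists>r. h = r *\<^sub>R (u, 0)"
      by (auto simp: span_singleton)
  qed
  then obtain e n where frame: "projection_frame cmul cJ cstar e n" and sum_e: "(\<Sum>i<n. e i) = (u, 0)"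
    using A.projection_frame_exists[OF _ cu] by blast
  interpret F: projection_frame cmul cJ cstar e n by (rule frame)
  \<comment> \<open>The generators are the \<open>L0\<close> components of \<open>diagonal\<close>
    and \<open>off_diagonal\<close>; the shifts \<open>\<alpha>\<close> and \<open>\<beta>\<close>
    are their components along \<open>u\<close>.\<close>
  obtain \<alpha> a where a: "a \<in> L0" "fst F.diagonal = \<alpha> *\<^sub>R u + a" using dec by blast
  obtain \<beta> b where b: "b \<in> L0" "fst F.off_diagonal = \<beta> *\<^sub>R u + b" using dec by blast
  have a': "F.diagonal - \<alpha> *\<^sub>R (u, 0) = (a, 0)"
    using F.star_diagonal[unfolded cstar_fixed] a(2) by (metis add_diff_cancel_left' diff_Pair diff_zero scaleR_Pair scaleR_zero_right)
  have b': "F.off_diagonal - \<beta> *\<^sub>R (u, 0) = (b, 0)"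
    using F.star_off_diagonal[unfolded cstar_fixed] b(2) by (metis add_diff_cancel_left' diff_Pair diff_zero scaleR_Pair scaleR_zero_right)
  define W where "W = span (iterated_products lie {a, b})"
  have W_L0: "W \<subseteq> L0"
  proof -
    have "x \<in> L0" if "x \<in> iterated_products lie {a, b}" for x
      using that by induction (use a b lL in auto)
    then show ?thesis unfolding W_def using sL by (intro span_minimal) auto
  qed
  have W_lie: "lie x y \<in> W" if "x \<in> W" "y \<in> W" for x y
    using span_iterated_products_closed[OF lie_bilinear] that by (simp add: W_def)
  have sW: "subspace W" by (simp add: W_def)
  have ab: "a \<in> W" "b \<in> W" by (auto simp: W_def intro!: span_base iterated_products.generator)
  define M where "M = (\<lambda>x. (x, 0::'a)) ` W"
  have sM: "subspace M"
    unfolding M_def by (rule linear_subspace_image[OF _ sW]) (auto intro!: linearI)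
  have bM: "A.bracket x y \<in> M" if xy: "x \<in> M" "y \<in> M" for x y
  proof -
    obtain p q where pq: "x = (p, 0)" "y = (q, 0)" "p \<in> W" "q \<in> W" using xy by (auto simp: M_def)
    have "A.bracket x y = (2 *\<^sub>R lie p q, 0)"
      by (simp add: A.bracket_def pq cmul_real cJ_def jordan_sym[of q p] lie_antisym[of q p] scaleR_2)
    then show ?thesis using W_lie[OF pq(3,4)] sW by (auto simp: M_def subspace_scale)
  qed
  have "L0 \<subseteq> W"
  proof
    fix l assume l: "l \<in> L0"
    have "cstar (l, 0) = (l, 0)" by (simp add: cstar_def)
    then obtain m r where m: "m \<in> M" "(l, 0) = m + r *\<^sub>R (u, 0)"
      using F.selfadjoint_generated[OF sM bM, of \<alpha> \<beta> "(l, 0)"] a' b' ab sum_e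
      by (auto simp: M_def)
    then obtain w where w: "w \<in> W" "l = w + r *\<^sub>R u" by (auto simp: M_def)
    \<comment> \<open>The part along \<open>u\<close> is a difference of elements of
      \<open>L0\<close>, so it vanishes.\<close>
    then have "r *\<^sub>R u = l - w" by simp
    also have "\<dots> \<in> L0" using l w(1) W_L0 sL by (blast intro: subspace_diff)
    finally have "r *\<^sub>R u \<in> span {u} \<inter> L0" by (auto simp: span_singleton)
    then have "r *\<^sub>R u = 0" using inter by blast
    then show "l \<in> W" using w by (simp del: scaleR_eq_0_iff)
  qed
  then show ?thesis using that[OF a(1) b(1)] a(1) b(1) by (simp add: generates_def W_def)
qed

lemma jordan_generated_closed:
  fixes G :: "'a set"
  defines "S \<equiv> span (iterated_products jordan G)"
  assumes "a \<in> G" "b \<in> G" "lie a b \<in> G"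
  shows "span (iterated_products lie {a, b}) \<subseteq> S"
proof (rule jordan_closed_contains_lie_products)
  show "subspace S" by (simp add: S_def)
  show "jordan x y \<in> S" if "x \<in> S" "y \<in> S" for x y
    using span_iterated_products_closed[OF jordan_bilinear] that by (simp add: S_def)
  show "a \<in> S" "b \<in> S" "lie a b \<in> S"
    using assms by (auto simp: S_def intro!: span_base iterated_products.generator)
qed

lemma unital_jordan_generated:
  assumes ss: "unital_semisimple jordan lie u L0" and gen: "generates lie {a, b} L0"
  shows "generates jordan {u, a, b, lie a b} UNIV"
proof -
  define S where "S = span (iterated_products jordan {u, a, b, lie a b})"
  have "L0 \<subseteq> S"
    using gen jordan_generated_closed[of a "{u, a, b, lie a b}" b] by (auto simp: generates_def S_def)
  moreover have "u \<in> S" by (auto simp: S_def intro!: span_base iterated_products.generator)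
  moreover have "subspace S" by (simp add: S_def)
  moreover have "\<exists>r. \<exists>y\<in>L0. x = r *\<^sub>R u + y" for x
    using ss by (simp add: unital_semisimple_def)
  ultimately have "x \<in> S" for x by (metis subsetD subspace_add subspace_scale)
  then show ?thesis by (auto simp: generates_def S_def)
qed

end

theorem theorem5:
  fixes jordan lie :: "'a::real_vector \<Rightarrow> 'a \<Rightarrow> 'a"
  assumes "lie_jordan_algebra jordan lie"
  shows
    "(semisimple_lie lie UNIV \<longrightarrow>
        (\<exists>x y z. generates jordan {x, y, z} UNIV) \<and>
        (\<exists>a b. generates lie {a, b} UNIV) \<and>
        (\<forall>a b. generates lie {a, b} UNIV \<longrightarrow> generates jordan {a, b, lie a b} UNIV)) \<and>
     (\<forall>u L0. unital_semisimple jordan lie u L0 \<longrightarrow>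
        (\<exists>x y z. generates jordan {u, x, y, z} UNIV) \<and>
        (\<exists>a\<in>L0. \<exists>b\<in>L0. generates lie {a, b} L0) \<and>
        (\<forall>a\<in>L0. \<forall>b\<in>L0. generates lie {a, b} L0 \<longrightarrow>
           generates jordan {u, a, b, lie a b} UNIV))"
proof -
  interpret lie_jordan_algebra jordan lie by (rule assms)
  have jordan: "generates jordan {a, b, lie a b} UNIV" if "generates lie {a, b} UNIV" for a b
    using that jordan_generated_closed[of a "{a, b, lie a b}" b] by (auto simp: generates_def)
  \<comment> \<open>The non-unital algebra is zero, so \<open>0\<close> generates it.\<close>
  have lie: "generates lie {0, 0} UNIV" if "semisimple_lie lie UNIV"
    using semisimple_nonunital_trivial[OF that] by (auto simp: generates_def) (metis span_0)
  show ?thesis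
  proof (intro conjI impI allI ballI)
    assume "semisimple_lie lie UNIV"
    note gen = lie[OF this]
    show "\<exists>a b. generates lie {a, b} UNIV" using gen by blast
    show "\<exists>x y z. generates jordan {x, y, z} UNIV" using jordan[OF gen] by blast
    show "generates jordan {a, b, lie a b} UNIV" if "generates lie {a, b} UNIV" for a b
      using that by (rule jordan)
  next
    fix u L0 assume ss: "unital_semisimple jordan lie u L0"
    obtain a b where ab: "a \<in> L0" "b \<in> L0" "generates lie {a, b} L0"
      using unital_two_generators[OF ss] by blast
    then show "\<exists>a\<in>L0. \<exists>b\<in>L0. generates lie {a, b} L0" by blast
    show "\<exists>x y z. generates jordan {u, x, y, z} UNIV"
      using unital_jordan_generated[OF ss ab(3)] by blast
    show "generates jordan {u, a, b, lie a b} UNIV" if "generates lie {a, b} L0" for a b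
      using ss that by (rule unital_jordan_generated)
  qed
qed

end
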